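(* Let $\mathcal{T}\in\mathbb{R}^{n_1\times\cdots\times n_d}$ satisfy $\mathcal{T}=(U_1^{\#},\dots,U_d^{\#}).\mathcal{G}^{\#}$ where $U_i^{\#}\in\mathbb{R}^{n_i\times r_i}_+$ with $(U_i^{\#})^\top e=e$ for $i\in[d]$ and $\mathcal{G}^{\#}\in\mathbb{R}^{r_1\times\cdots\times r_d}$. Let $\mathcal{I}\subsetneq[d]$ be a non-empty set, with complement $\mathcal{I}^-=[d]\setminus\mathcal{I}$, such that $\bigotimes_{i\in S}U_i^{\#}$ satisfies the SSC for $S\in\{\mathcal{I},\mathcal{I}^-\}$ and $\operatorname{rank}(\mathcal{G}^{\#}_{\mathcal{I}})=\prod_{i\in\mathcal{I}}r_i=\prod_{j\in\mathcal{I}^-}r_j$. Write $n_S=\prod_{i\in S}n_i$, $r_S=\prod_{i\in S}r_i$. Let $(U_1^*,\dots,U_d^*,\mathcal{G}^* )$ be any output of the following procedure: 1. Let $(U_{\mathcal{I}}^*,U_{\mathcal{I}^-}^*,G^* )$ be an optimal solution of $$\min_{U_{\mathcal{I}}\in\mathbb{R}^{n_{\mathcal{I}}\times r_{\mathcal{I}}},\,U_{\mathcal{I}^-}\in\mathbb{R}^{n_{\mathcal{I}^-}\times r_{\mathcal{I}^-}},\,G\in\mathbb{R}^{r_{\mathcal{I}^-}\times r_{\mathcal{I}}}}|\det(G)|\ \text{ such that }\ \mathcal{T}_{\mathcal{I}}=U_{\mathcal{I}^-}GU_{\mathcal{I}}^\top,\ U_{\mathcal{I}}^\top e=e,\ U_{\mathcal{I}^-}^\top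 e=e,\ U_{\mathcal{I}}\ge0,\ U_{\mathcal{I}^-}\ge0.$$ 2. For $S\in\{\mathcal{I},\mathcal{I}^-\}$, let $\Pi_S^*$ be a permutation matrix such that $U_S^*\Pi_S^*=\bigotimes_{j\in S}U_j^*$ for some $U_j^*\in\mathbb{R}^{n_j\times r_j}$ with $(U_j^* )^\top e=e$ for all $j\in S$. 3. Let $\mathcal{G}^*\in\mathbb{R}^{r_1\times\cdots\times r_d}$ be the tensor whose unfolding along $\mathcal{I}$ is $\mathcal{G}^*_{\mathcal{I}}=(\Pi_{\mathcal{I}^-}^* )^\top G^*\Pi_{\mathcal{I}}^*$. Then there exist permutation matrices $\Pi_i$ for $i\in[d]$ such that $U_i^*=U_i^{\#}\Pi_i$ for all $i\in[d]$ and $\mathcal{G}^*=(\Pi_1^\top,\dots,\Pi_d^\top).\mathcal{G}^{\#}$.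
   Context: $[d]=\{1,\dots,d\}$, $e$ is the all-ones vector of appropriate dimension, $e_k$ the $k$-th standard basis vector, and $\ge$ is entrywise. For $U_i\in\mathbb{R}^{n_i\times r_i}$ and $\mathcal{G}\in\mathbb{R}^{r_1\times\cdots\times r_d}$, $(U_1,\dots,U_d).\mathcal{G}\in\mathbb{R}^{n_1\times\cdots\times n_d}$ is the tensor with entries $\sum_{i_1,\dots,i_d}\big(\prod_{t=1}^d(U_t)_{j_t,i_t}\big)\mathcal{G}_{i_1,\dots,i_d}$. For $S\subseteq[d]$ and a tuple $(i_1,\dots,i_d)$, $i_S$ denotes the subtuple $(i_j)_{j\in S}$. The unfolding of $\mathcal{T}$ along $\mathcal{I}$, denoted $\mathcal{T}_{\mathcal{I}}$, is the $\prod_{j\in\mathcal{I}^-}n_j\times\prod_{j\in\mathcal{I}}n_j$ matrix with $(i_{\mathcal{I}^-},i_{\mathcal{I}})$ entry $\mathcal{T}_{i_1,\dots,i_d}$. The Kronecker product $\bigotimes_{j\in S}U_j$ is the $\prod_{j\in S}n_j\times\prod_{j\in S}r_j$ matrix with $(k_S,i_S)$ entry $\prod_{j\in S}(U_j)_{k_j,i_j}$. Rows and columns of all these matrices are indexed by tuples, with one fixed linear ordering of tuples used consistently throughout. For $A\in\mathbb{R}^{m\times n}$, $\operatorname{cone}(A)=\{Ay : y\in\mathbb{R}^n, y\ge 0\}$ and $\operatorname{cone}^*(A)=\{y\in\mathbb{R}^m : A^\top y\ge 0\}$. A matrix $H\in\mathbb{R}^{n\times r}_+$ with $r\ge2$ satisfies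 the sufficiently scattered condition (SSC) if: (SSC1) $\{x\in\mathbb{R}^r_+ : e^\top x\ge\sqrt{r-1}\,\|x\|_2\}\subseteq\operatorname{cone}(H^\top)$; and (SSC2) $\operatorname{cone}^*(H^\top)\cap\operatorname{bd}(\mathcal{C}^* )=\{\lambda e_k : \lambda\ge0,\ k\in\{1,\dots,r\}\}$, where $\mathcal{C}^*=\{x\in\mathbb{R}^r : e^\top x\ge\|x\|_2\}$ and $\operatorname{bd}$ denotes the boundary. *)

theory Defs
  imports
    "HOL-Analysis.L2_Norm"
    "HOL-Analysis.Abstract_Metric_Spaces"
    "Jordan_Normal_Form.DL_Rank"
begin

subsection \<open>Vectors, cones and the sufficiently scattered condition\<close>

definition ones :: "nat \<Rightarrow> real vec" where
  "ones n = vec n (\<lambda>_. 1)"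

definition vnorm :: "real vec \<Rightarrow> real" where
  "vnorm x = L2_set (\<lambda>i. x $ i) {..<dim_vec x}"

text \<open>The distance sums over \<open>{..<r}\<close>, rather than being \<open>vnorm (x - y)\<close>, because
  \<^locale>\<open>Metric_space\<close> requires symmetry also outside of the carrier.\<close>

definition vdist :: "nat \<Rightarrow> real vec \<Rightarrow> real vec \<Rightarrow> real" where
  "vdist r x y = L2_set (\<lambda>i. x $ i - y $ i) {..<r}"

lemma vdist_eq_vnorm:
  "x \<in> carrier_vec r \<Longrightarrow> y \<in> carrier_vec r \<Longrightarrow> vdist r x y = vnorm (x - y)"
  by (auto simp: vdist_def vnorm_def L2_set_def intro!: sum.cong)

lemma Metric_space_vdist: "Metric_space (carrier_vec r) (vdist r)"
proof
  fix x y z :: "real vec"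
  show "0 \<le> vdist r x y"
    by (simp add: vdist_def)
  show "vdist r x y = vdist r y x"
    by (simp add: vdist_def L2_set_def power2_commute)
  show "vdist r x y = 0 \<longleftrightarrow> x = y" if "x \<in> carrier_vec r" "y \<in> carrier_vec r"
    using that by (auto simp: vdist_def L2_set_eq_0_iff intro!: eq_vecI)
  show "vdist r x z \<le> vdist r x y + vdist r y z"
    using L2_set_triangle_ineq[of "\<lambda>i. x $ i - y $ i" "\<lambda>i. y $ i - z $ i" "{..<r}"]
    by (simp add: vdist_def)
qed

definition euclidean_vec_topology :: "nat \<Rightarrow> real vec topology" where
  "euclidean_vec_topology r = Metric_space.mtopology (carrier_vec r) (vdist r)"

definition cone :: "real mat \<Rightarrow> real vec set" where
  "cone A = {A *\<^sub>v y | y. y \<in> carrier_vec (dim_col A) \<and> 0\<^sub>v (dim_col A) \<le> y}"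

definition dual_cone :: "real mat \<Rightarrow> real vec set" where
  "dual_cone A = {y \<in> carrier_vec (dim_row A). 0\<^sub>v (dim_col A) \<le> transpose_mat A *\<^sub>v y}"

text \<open>The cone written \<open>\<C>\<^sup>*\<close>.\<close>

definition dual_ice_cream_cone :: "nat \<Rightarrow> real vec set" where
  "dual_ice_cream_cone r = {x \<in> carrier_vec r. ones r \<bullet> x \<ge> vnorm x}"

definition satisfies_SSC :: "real mat \<Rightarrow> bool" where
  "satisfies_SSC H \<longleftrightarrow>
     (let r = dim_col H in
       2 \<le> r \<and> 0\<^sub>m (dim_row H) r \<le> H \<and>
       {x \<in> carrier_vec r. 0\<^sub>v r \<le> x \<and> ones r \<bullet> x \<ge> sqrt (real r - 1) * vnorm x}
         \<subseteq> cone (transpose_mat H) \<and>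
       dual_cone (transpose_mat H)
           \<inter> (euclidean_vec_topology r frontier_of dual_ice_cream_cone r)
         = {c \<cdot>\<^sub>v unit_vec r k | c k. 0 \<le> c \<and> k < r})"

definition sum_to_one_columns :: "real mat \<Rightarrow> bool" where
  "sum_to_one_columns U \<longleftrightarrow> transpose_mat U *\<^sub>v ones (dim_row U) = ones (dim_col U)"

definition permutation_matrix :: "nat \<Rightarrow> real mat \<Rightarrow> bool" where
  "permutation_matrix r P \<longleftrightarrow>
     (\<exists>p. p permutes {..<r} \<and> P = mat r r (\<lambda>(i, j). if i = p j then 1 else 0))"

subsection \<open>Tensors\<close>

text \<open>Index tuples over the positions \<open>S\<close> are extensional functions whose entry at position
  \<open>j\<close> ranges over \<open>{..<m j}\<close>; thus positions run over \<open>{1..d}\<close> while entries are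
  counted from 0, as for matrices.  A tensor of format \<open>n 1 \<times> \<dots> \<times> n d\<close> is a function on
  tuples, of which only the values on \<open>tuples {1..d} n\<close> are meaningful.\<close>

type_synonym tuple = "nat \<Rightarrow> nat"
type_synonym tensor = "tuple \<Rightarrow> real"

definition tuples :: "nat set \<Rightarrow> (nat \<Rightarrow> nat) \<Rightarrow> tuple set" where
  "tuples S m = (\<Pi>\<^sub>E j\<in>S. {..<m j})"

text \<open>A fixed ordering of the tuples: \<open>enum A k\<close> is the \<open>k\<close>-th element of the finite set of
  tuples \<open>A\<close>.  Every linear order on tuples induces such an enumeration.\<close>

definition tuple_ordering :: "(tuple set \<Rightarrow> nat \<Rightarrow> tuple) \<Rightarrow> bool" where
  "tuple_ordering enum \<longleftrightarrow> (\<forall>A. finite A \<longrightarrow> bij_betw (enum A) {..<card A} A)"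

lemma ex_tuple_ordering: "\<exists>enum. tuple_ordering enum"
  unfolding tuple_ordering_def lessThan_atLeast0
  using ex_bij_betw_nat_finite by metis

definition multilinear_mult :: "nat \<Rightarrow> (nat \<Rightarrow> real mat) \<Rightarrow> tensor \<Rightarrow> tensor" where
  "multilinear_mult d U G =
     (\<lambda>j. \<Sum>i\<in>tuples {1..d} (\<lambda>t. dim_col (U t)). (\<Prod>t\<in>{1..d}. U t $$ (j t, i t)) * G i)"

definition tensor_unfolding ::
  "(tuple set \<Rightarrow> nat \<Rightarrow> tuple) \<Rightarrow> nat \<Rightarrow> (nat \<Rightarrow> nat) \<Rightarrow> nat set \<Rightarrow> tensor \<Rightarrow> real mat" where
  "tensor_unfolding enum d n I T =
     (let J = {1..d} - I in
       mat (\<Prod>j\<in>J. n j) (\<Prod>j\<in>I. n j)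
         (\<lambda>(a, b). T (\<lambda>j. if j \<in> I then enum (tuples I n) b j else enum (tuples J n) a j)))"

definition kronecker ::
  "(tuple set \<Rightarrow> nat \<Rightarrow> tuple) \<Rightarrow> nat set \<Rightarrow> (nat \<Rightarrow> real mat) \<Rightarrow> real mat" where
  "kronecker enum S U =
     (let n = (\<lambda>j. dim_row (U j)); r = (\<lambda>j. dim_col (U j)) in
       mat (\<Prod>j\<in>S. n j) (\<Prod>j\<in>S. r j)
         (\<lambda>(a, b). \<Prod>j\<in>S. U j $$ (enum (tuples S n) a j, enum (tuples S r) b j)))"

subsection \<open>The procedure\<close>

definition feasible ::
  "nat \<Rightarrow> nat \<Rightarrow> nat \<Rightarrow> nat \<Rightarrow> real mat \<Rightarrow> real mat \<Rightarrow> real mat \<Rightarrow> real mat \<Rightarrow> bool" where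
  "feasible nI nJ rI rJ M UI UJ G \<longleftrightarrow>
     UI \<in> carrier_mat nI rI \<and> UJ \<in> carrier_mat nJ rJ \<and> G \<in> carrier_mat rJ rI \<and>
     M = UJ * G * transpose_mat UI \<and>
     sum_to_one_columns UI \<and> sum_to_one_columns UJ \<and>
     0\<^sub>m nI rI \<le> UI \<and> 0\<^sub>m nJ rJ \<le> UJ"

definition optimal_solution ::
  "nat \<Rightarrow> nat \<Rightarrow> nat \<Rightarrow> nat \<Rightarrow> real mat \<Rightarrow> real mat \<Rightarrow> real mat \<Rightarrow> real mat \<Rightarrow> bool" where
  "optimal_solution nI nJ rI rJ M UI UJ G \<longleftrightarrow>
     feasible nI nJ rI rJ M UI UJ G \<and>
     (\<forall>VI VJ K. feasible nI nJ rI rJ M VI VJ K \<longrightarrow> \<bar>det G\<bar> \<le> \<bar>det K\<bar>)"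

definition procedure_output ::
  "(tuple set \<Rightarrow> nat \<Rightarrow> tuple) \<Rightarrow> nat \<Rightarrow> (nat \<Rightarrow> nat) \<Rightarrow> (nat \<Rightarrow> nat) \<Rightarrow> nat set \<Rightarrow> tensor
    \<Rightarrow> (nat \<Rightarrow> real mat) \<Rightarrow> tensor \<Rightarrow> bool" where
  "procedure_output enum d n r I T U G \<longleftrightarrow>
     (let J = {1..d} - I in
       \<exists>UI UJ Gmat PI PJ.
         optimal_solution (\<Prod>i\<in>I. n i) (\<Prod>j\<in>J. n j) (\<Prod>i\<in>I. r i) (\<Prod>j\<in>J. r j)
           (tensor_unfolding enum d n I T) UI UJ Gmat \<and>
         permutation_matrix (\<Prod>i\<in>I. r i) PI \<and> permutation_matrix (\<Prod>j\<in>J. r j) PJ \<and>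
         (\<forall>j\<in>{1..d}. U j \<in> carrier_mat (n j) (r j) \<and> sum_to_one_columns (U j)) \<and>
         UI * PI = kronecker enum I U \<and> UJ * PJ = kronecker enum J U \<and>
         tensor_unfolding enum d r I G = transpose_mat PJ * Gmat * PI)"

end

theory Submission
  imports Defs
begin

text \<open>Write \<open>A\<close>, \<open>B\<close> for the Kronecker products of the true factors over \<open>\<I>\<close> and \<open>\<I>\<^sup>-\<close>, so that
  \<open>\<T>\<^sub>\<I> = B G A\<^sup>T\<close>.  A feasible triple \<open>(U, V, K)\<close> with \<open>\<bar>det K\<bar> \<le> \<bar>det G\<bar>\<close> satisfies
  \<open>U = A P\<close>, \<open>V = B Q\<close> and \<open>G = Q K P\<^sup>T\<close>, whence \<open>\<bar>det P\<bar> \<bar>det Q\<bar> \<ge> 1\<close>.  Each column \<open>q\<close> of \<open>P\<close> has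
  entry sum 1 and \<open>A q \<ge> 0\<close>, so SSC1 and cone duality give \<open>\<parallel>q\<parallel> \<le> e\<^sup>T q = 1\<close>, and Hadamard's
  inequality forces equality throughout.  Thus \<open>q\<close> lies on the boundary of \<open>\<C>\<^sup>*\<close>, and by SSC2 it is
  a unit vector; hence \<open>P\<close>, and likewise \<open>Q\<close>, is a permutation matrix.  Since all factors have
  column sums 1, each factor is a marginal of its Kronecker product; a permutation of the columns
  of the product matching two Kronecker products therefore acts on tuples coordinatewise.\<close>

subsection \<open>Hadamard's inequality\<close>

lemma transpose_mult_diag:
  fixes A :: "real mat"
  assumes "A \<in> carrier_mat m n" "k < n"
  shows "(transpose_mat A * A) $$ (k, k) = (\<Sum>i<m. (A $$ (i, k))\<^sup>2)"
  using assms by (auto simp: scalar_prod_def power2_eq_square lessThan_atLeast0 intro!: sum.cong)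

text \<open>\<open>H\<close> is the reflection in the hyperplane orthogonal to \<open>w\<close>. As
  \<open>s\<close> is the norm of \<open>a\<close>, the vectors \<open>a\<close> and
  \<open>s\<close> times the unit vector have equal length, so the reflection swaps them.\<close>

lemma householder_exists:
  fixes a :: "real vec"
  assumes a: "a \<in> carrier_vec n" and n: "0 < n"
  obtains H s where "H \<in> carrier_mat n n" "transpose_mat H * H = 1\<^sub>m n"
    "H *\<^sub>v a = s \<cdot>\<^sub>v unit_vec n 0"
proof -
  define s where "s = L2_set (\<lambda>i. a $ i) {..<n}"
  define w where "w = a - s \<cdot>\<^sub>v unit_vec n 0"
  have w: "w \<in> carrier_vec n"
    using a by (simp add: w_def)
  show ?thesis
  proof (cases "w = 0\<^sub>v n")
    \<comment> \<open>There is no direction to reflect along; \<open>a\<close> is already a multiple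
      of the unit vector and the identity serves.\<close>
    case True
    have "a = s \<cdot>\<^sub>v unit_vec n 0"
    proof (rule eq_vecI)
      fix i assume i: "i < dim_vec (s \<cdot>\<^sub>v unit_vec n 0)"
      have "w $ i = 0" using True i by simp
      then show "a $ i = (s \<cdot>\<^sub>v unit_vec n 0) $ i"
        using i a by (simp add: w_def)
    qed (use a in auto)
    then show ?thesis
      using that[of "1\<^sub>m n" s] a by simp
  next
    case False
    define N where "N = (\<Sum>k<n. (w $ k)\<^sup>2)"
    have N0: "N \<noteq> 0"
    proof
      assume "N = 0"
      then have "\<And>k. k < n \<Longrightarrow> w $ k = 0"
        by (simp add: N_def sum_nonneg_eq_0_iff)
      then have "w = 0\<^sub>v n" using w by auto
      then show False using False by simp
    qed
    \<comment> \<open>With this factor I - c w w^T is a reflection; the computations below use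
      \<open>c\<close> only through \<open>c * N = 2\<close>.\<close>
    define c where "c = 2 / N"
    have cN: "c * N = 2" using N0 by (simp add: c_def)
    define H where "H = mat n n (\<lambda>(i, j). (if i = j then 1 else 0) - c * w $ i * w $ j)"
    have H: "H \<in> carrier_mat n n" by (simp add: H_def)
    have "transpose_mat H * H = 1\<^sub>m n"
    proof (rule eq_matI)
      fix i j assume ij: "i < dim_row (1\<^sub>m n)" "j < dim_col (1\<^sub>m n)"
      have "(transpose_mat H * H) $$ (i, j) = (\<Sum>k<n. H $$ (k, i) * H $$ (k, j))"
        using ij H by (simp add: scalar_prod_def lessThan_atLeast0)
      also have "\<dots> = (\<Sum>k<n. (if k = i then (if i = j then 1 else 0) else 0)
            - c * w $ j * (if k = i then w $ k else 0)
            - c * w $ i * (if k = j then w $ k else 0)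
            + c\<^sup>2 * w $ i * w $ j * (w $ k)\<^sup>2)"
        using ij by (intro sum.cong) (auto simp: H_def algebra_simps power2_eq_square)
      also have "\<dots> = (if i = j then 1 else 0) - c * w $ j * w $ i - c * w $ i * w $ j
            + c\<^sup>2 * w $ i * w $ j * N"
        using ij by (simp add: sum.distrib sum_subtractf sum_distrib_left[symmetric] N_def)
      also have "\<dots> = (if i = j then 1 else 0) - 2 * c * (w $ i * w $ j) + (c * N) * c * (w $ i * w $ j)"
        by (simp add: power2_eq_square algebra_simps)
      also have "\<dots> = (if i = j then 1 else 0)"
        by (simp add: cN)
      finally show "(transpose_mat H * H) $$ (i, j) = 1\<^sub>m n $$ (i, j)"
        using ij by simp
    qed (use H in auto)
    moreover have "H *\<^sub>v a = s \<cdot>\<^sub>v unit_vec n 0"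
    proof (rule eq_vecI)
      fix i assume "i < dim_vec (s \<cdot>\<^sub>v unit_vec n 0)"
      then have i: "i < n" by simp
      have s2: "s\<^sup>2 = (\<Sum>k<n. (a $ k)\<^sup>2)"
        by (simp add: s_def L2_set_def sum_nonneg)
      have wk: "w $ k = a $ k - s * (if k = 0 then 1 else 0)" if "k < n" for k
        using that a n by (simp add: w_def unit_vec_def)
      have "(\<Sum>k<n. w $ k * a $ k) = (\<Sum>k<n. (a $ k)\<^sup>2 - (if k = 0 then s * a $ k else 0))"
        by (intro sum.cong) (auto simp: wk power2_eq_square algebra_simps)
      also have "\<dots> = s\<^sup>2 - s * a $ 0"
        using n by (simp add: sum_subtractf s2)
      finally have wa: "(\<Sum>k<n. w $ k * a $ k) = s\<^sup>2 - s * a $ 0" .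
      \<comment> \<open>The squared length of \<open>w\<close> is twice its product with
        \<open>a\<close>, so \<open>H\<close> subtracts exactly \<open>w\<close> from
        \<open>a\<close>.\<close>
      have "N = (\<Sum>k<n. (a $ k)\<^sup>2 + (if k = 0 then s\<^sup>2 - 2 * s * a $ k else 0))"
        unfolding N_def by (intro sum.cong) (auto simp: wk power2_eq_square algebra_simps)
      also have "\<dots> = 2 * (s\<^sup>2 - s * a $ 0)"
        using n by (simp add: sum.distrib s2)
      finally have N: "N = 2 * (\<Sum>k<n. w $ k * a $ k)" using wa by simp
      have "(H *\<^sub>v a) $ i = (\<Sum>k<n. H $$ (i, k) * a $ k)"
        using i H a by (simp add: scalar_prod_def lessThan_atLeast0)
      also have "\<dots> = (\<Sum>k<n. (if k = i then a $ k else 0) - c * w $ i * (w $ k * a $ k))"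
        using i by (intro sum.cong) (auto simp: H_def algebra_simps)
      also have "\<dots> = a $ i - c * w $ i * (\<Sum>k<n. w $ k * a $ k)"
        using i by (simp add: sum_subtractf sum_distrib_left[symmetric])
      also have "\<dots> = a $ i - w $ i"
        using N cN by (simp add: algebra_simps)
      also have "\<dots> = (s \<cdot>\<^sub>v unit_vec n 0) $ i"
        using i a by (simp add: w_def)
      finally show "(H *\<^sub>v a) $ i = (s \<cdot>\<^sub>v unit_vec n 0) $ i" .
    qed (use H in auto)
    ultimately show ?thesis using that H by blast
  qed
qed

text \<open>Induction on \<open>n\<close>: an orthogonal factor on the left changes neither the
  squared determinant nor the column norms, so the first column may be rotated onto the first axis.
  Laplace expansion then leaves \<open>s\<close> times a minor whose columns have only become
  shorter.\<close>

theorem hadamard_inequality: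
  fixes A :: "real mat"
  assumes "A \<in> carrier_mat n n"
  shows "(det A)\<^sup>2 \<le> (\<Prod>k<n. \<Sum>i<n. (A $$ (i, k))\<^sup>2)"
  using assms
proof (induction n arbitrary: A)
  case 0
  then show ?case by simp
next
  case (Suc n)
  obtain H s where H: "H \<in> carrier_mat (Suc n) (Suc n)" "transpose_mat H * H = 1\<^sub>m (Suc n)"
    and Ha: "H *\<^sub>v col A 0 = s \<cdot>\<^sub>v unit_vec (Suc n) 0"
    using householder_exists[of "col A 0" "Suc n"] Suc.prems by (metis col_carrier_vec zero_less_Suc carrier_matD(2) carrier_matD(1) col_dim)
  define B where "B = H * A"
  have B: "B \<in> carrier_mat (Suc n) (Suc n)"
    using H Suc.prems by (simp add: B_def)
  have "(det H)\<^sup>2 = 1"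
    using arg_cong[OF H(2), of det] H(1)
    by (simp add: det_mult[of _ "Suc n"] det_transpose power2_eq_square)
  then have det_B: "(det B)\<^sup>2 = (det A)\<^sup>2"
    using H(1) Suc.prems by (simp add: B_def det_mult[of _ "Suc n"] power_mult_distrib)
  \<comment> \<open>The squared column norms are the diagonal of the Gram matrix, which
    \<open>H\<close> leaves unchanged.\<close>
  have "transpose_mat B * B = transpose_mat A * (transpose_mat H * (H * A))"
    using H(1) Suc.prems unfolding B_def
    by (simp add: transpose_mult[of _ "Suc n" "Suc n"] assoc_mult_mat[of _ "Suc n" "Suc n" _ "Suc n" _ "Suc n"])
  also have "\<dots> = transpose_mat A * ((transpose_mat H * H) * A)"
    using H(1) Suc.prems by (subst assoc_mult_mat[of "transpose_mat H" "Suc n" "Suc n" _ "Suc n" _ "Suc n"]) auto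
  also have "\<dots> = transpose_mat A * A"
    using H(2) Suc.prems by simp
  finally have gram: "transpose_mat B * B = transpose_mat A * A" .
  have norms: "(\<Sum>i<Suc n. (B $$ (i, k))\<^sup>2) = (\<Sum>i<Suc n. (A $$ (i, k))\<^sup>2)" if "k < Suc n" for k
    using gram transpose_mult_diag[OF B that] transpose_mult_diag[OF Suc.prems that] by simp
  have B0: "B $$ (i, 0) = (if i = 0 then s else 0)" if "i < Suc n" for i
  proof -
    have "B $$ (i, 0) = (H *\<^sub>v col A 0) $ i"
      using that H(1) Suc.prems by (simp add: B_def)
    then show ?thesis using that Ha by (simp add: unit_vec_def)
  qed
  have M: "mat_delete B 0 0 \<in> carrier_mat n n"
    using mat_delete_carrier[OF B, of 0 0] by simp
  have "det B = (\<Sum>i<Suc n. B $$ (i, 0) * cofactor B i 0)"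
    by (rule laplace_expansion_column[OF B]) simp
  also have "\<dots> = (\<Sum>i<Suc n. if i = 0 then s * cofactor B i 0 else 0)"
    by (intro sum.cong) (auto simp: B0)
  also have "\<dots> = s * det (mat_delete B 0 0)"
    by (simp add: cofactor_def)
  finally have "(det B)\<^sup>2 = s\<^sup>2 * (det (mat_delete B 0 0))\<^sup>2"
    by (simp add: power_mult_distrib)
  also have "\<dots> \<le> s\<^sup>2 * (\<Prod>k<n. \<Sum>i<n. (mat_delete B 0 0 $$ (i, k))\<^sup>2)"
    by (intro mult_left_mono Suc.IH M) simp
  \<comment> \<open>Deleting row 0 drops one square from the sum of each remaining column.\<close>
  also have "\<dots> \<le> s\<^sup>2 * (\<Prod>k<n. \<Sum>i<Suc n. (B $$ (i, Suc k))\<^sup>2)"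
  proof (intro mult_left_mono prod_mono conjI sum_nonneg)
    fix k assume k: "k \<in> {..<n}"
    have "(\<Sum>i<n. (mat_delete B 0 0 $$ (i, k))\<^sup>2) = (\<Sum>i<n. (B $$ (Suc i, Suc k))\<^sup>2)"
      using k B by (intro sum.cong) (auto simp: mat_delete_def)
    also have "\<dots> \<le> (\<Sum>i<Suc n. (B $$ (i, Suc k))\<^sup>2)"
      by (subst sum.lessThan_Suc_shift) simp
    finally show "(\<Sum>i<n. (mat_delete B 0 0 $$ (i, k))\<^sup>2) \<le> (\<Sum>i<Suc n. (B $$ (i, Suc k))\<^sup>2)" .
  qed auto
  also have "s\<^sup>2 = (\<Sum>i<Suc n. (B $$ (i, 0))\<^sup>2)"
  proof -
    have "(\<Sum>i<Suc n. (B $$ (i, 0))\<^sup>2) = (\<Sum>i<Suc n. if i = 0 then s\<^sup>2 else 0)"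
      by (intro sum.cong) (auto simp: B0)
    then show ?thesis by simp
  qed
  also have "(\<Sum>i<Suc n. (B $$ (i, 0))\<^sup>2) * (\<Prod>k<n. \<Sum>i<Suc n. (B $$ (i, Suc k))\<^sup>2)
      = (\<Prod>k<Suc n. \<Sum>i<Suc n. (B $$ (i, k))\<^sup>2)"
    by (rule prod.lessThan_Suc_shift[symmetric])
  also have "\<dots> = (\<Prod>k<Suc n. \<Sum>i<Suc n. (A $$ (i, k))\<^sup>2)"
    using norms by (intro prod.cong) auto
  finally show ?case using det_B by simp
qed

text \<open>A kernel vector x of the Gram matrix satisfies |A x|^2 = 0, so injectivity makes the
  Gram matrix invertible; its inverse times A^T is the pseudoinverse.\<close>

lemma left_inverse_exists:
  fixes A :: "real mat"
  assumes A: "A \<in> carrier_mat m n"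
    and inj: "\<And>x. x \<in> carrier_vec n \<Longrightarrow> A *\<^sub>v x = 0\<^sub>v m \<Longrightarrow> x = 0\<^sub>v n"
  obtains L where "L \<in> carrier_mat n m" "L * A = 1\<^sub>m n"
proof -
  define M where "M = transpose_mat A * A"
  have M: "M \<in> carrier_mat n n" using A by (simp add: M_def)
  have "det M \<noteq> 0"
  proof
    assume "det M = 0"
    then obtain x where x: "x \<in> carrier_vec n" "x \<noteq> 0\<^sub>v n" "M *\<^sub>v x = 0\<^sub>v n"
      using det_0_iff_vec_prod_zero[OF M] by blast
    have "(A *\<^sub>v x) \<bullet> (A *\<^sub>v x) = (M *\<^sub>v x) \<bullet> x"
      using transpose_vec_mult_scalar[OF A x(1), of "A *\<^sub>v x"] A x(1)
      by (simp add: M_def assoc_mult_mat_vec[of _ n m _ n])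
    then have "(\<Sum>i<m. ((A *\<^sub>v x) $ i)\<^sup>2) = 0"
      using x A by (simp add: scalar_prod_def power2_eq_square lessThan_atLeast0)
    then have "\<And>i. i < m \<Longrightarrow> (A *\<^sub>v x) $ i = 0"
      by (simp add: sum_nonneg_eq_0_iff)
    then have "A *\<^sub>v x = 0\<^sub>v m" using A by (intro eq_vecI) auto
    then show False using inj x by blast
  qed
  then obtain N where N: "N \<in> carrier_mat n n" "N * M = 1\<^sub>m n"
    using det_non_zero_imp_unit[OF M, of undefined] by (auto simp: Units_def ring_mat_def)
  show ?thesis
  proof
    show "N * transpose_mat A \<in> carrier_mat n m" using N A by simp
    show "N * transpose_mat A * A = 1\<^sub>m n"
      using N A by (simp add: M_def assoc_mult_mat[of _ n n _ m _ n])
  qed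
qed

subsection \<open>The sufficiently scattered condition\<close>

lemma ones_scalar_prod: "x \<in> carrier_vec r \<Longrightarrow> ones r \<bullet> x = (\<Sum>i<r. x $ i)"
  by (simp add: ones_def scalar_prod_def lessThan_atLeast0)

lemma vnorm_power2: "x \<in> carrier_vec r \<Longrightarrow> (vnorm x)\<^sup>2 = (\<Sum>i<r. (x $ i)\<^sup>2)"
  by (simp add: vnorm_def L2_set_def sum_nonneg)

lemma vnorm_nonneg: "0 \<le> vnorm x"
  by (simp add: vnorm_def)

text \<open>If one entry were negative, the other r - 1 entries would sum to more than sqrt (r - 1)
  times the norm, against Cauchy-Schwarz. This supplies the nonnegativity clause of SSC1 for the
  test vectors used below.\<close>

lemma ice_cream_cone_nonneg:
  assumes x: "x \<in> carrier_vec r" and le: "sqrt (real r - 1) * vnorm x \<le> ones r \<bullet> x" and r: "1 \<le> r"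
  shows "0\<^sub>v r \<le> x"
proof -
  have "0 \<le> x $ k" if k: "k < r" for k
  proof (rule ccontr)
    assume neg: "\<not> 0 \<le> x $ k"
    define S where "S = (\<Sum>i\<in>{..<r} - {k}. x $ i)"
    have sum: "ones r \<bullet> x = x $ k + S"
      using k unfolding ones_scalar_prod[OF x] S_def by (intro sum.remove) auto
    have "S\<^sup>2 \<le> (\<Sum>i\<in>{..<r} - {k}. (x $ i)\<^sup>2) * (real r - 1)"
      using sum_squared_le_sum_of_squares[of "\<lambda>i. x $ i" "{..<r} - {k}"] k r by (simp add: S_def of_nat_diff)
    also have "\<dots> \<le> (vnorm x)\<^sup>2 * (real r - 1)"
      using r unfolding vnorm_power2[OF x] by (intro mult_right_mono sum_mono2) auto
    also have "\<dots> = (sqrt (real r - 1) * vnorm x)\<^sup>2"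
      using r by (simp add: power_mult_distrib)
    finally have "S \<le> sqrt (real r - 1) * vnorm x"
      by (rule power2_le_imp_le) (use r in \<open>simp add: vnorm_nonneg\<close>)
    then show False using le sum neg by simp
  qed
  then show ?thesis using x by (auto simp: less_eq_vec_def)
qed

lemma satisfies_SSC_D:
  assumes "satisfies_SSC H" "H \<in> carrier_mat m r"
  shows "2 \<le> r" and "0\<^sub>m m r \<le> H"
    and "{x \<in> carrier_vec r. 0\<^sub>v r \<le> x \<and> ones r \<bullet> x \<ge> sqrt (real r - 1) * vnorm x}
         \<subseteq> cone (transpose_mat H)"
    and "dual_cone (transpose_mat H)
           \<inter> (euclidean_vec_topology r frontier_of dual_ice_cream_cone r)
         = {c \<cdot>\<^sub>v unit_vec r k | c k. 0 \<le> c \<and> k < r}"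
  using assms(1) unfolding satisfies_SSC_def Let_def carrier_matD[OF assms(2)] by blast+

text \<open>The vector \<open>e - t p\<close>, with \<open>p\<close> the projection of \<open>q\<close> orthogonal to \<open>e\<close> and \<open>t\<close> as
  large as the ice cream cone permits, is the most negative direction for \<open>q\<close>.\<close>

lemma SSC_nonneg_imp_vnorm_le:
  assumes ssc: "satisfies_SSC H" and H: "H \<in> carrier_mat m r" and q: "q \<in> carrier_vec r"
    and Hq: "0\<^sub>v m \<le> H *\<^sub>v q"
  shows "vnorm q \<le> ones r \<bullet> q"
proof -
  note r = satisfies_SSC_D(1)[OF ssc H] and sub = satisfies_SSC_D(3)[OF ssc H]
  \<comment> \<open>SSC1 writes \<open>x\<close> as H^T y with y nonnegative, so its product with
    \<open>q\<close> equals that of y with H q, a sum of nonnegative terms.\<close>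
  have dual: "0 \<le> (\<Sum>i<r. x $ i * q $ i)"
    if x: "x \<in> carrier_vec r" "sqrt (real r - 1) * vnorm x \<le> ones r \<bullet> x" for x
  proof -
    have "x \<in> cone (transpose_mat H)"
      by (intro subsetD[OF sub]) (use x ice_cream_cone_nonneg[OF x] r in simp)
    then obtain y where y: "y \<in> carrier_vec m" "0\<^sub>v m \<le> y" "x = transpose_mat H *\<^sub>v y"
      using H by (auto simp: cone_def)
    have "x \<bullet> q = y \<bullet> (H *\<^sub>v q)"
      using transpose_vec_mult_scalar[OF H q y(1)] y(3) by simp
    also have "\<dots> \<ge> 0"
      using y Hq unfolding scalar_prod_def less_eq_vec_def
      by (intro sum_nonneg mult_nonneg_nonneg) (auto simp del: index_mult_mat_vec)
    finally show ?thesis using q by (simp add: scalar_prod_def lessThan_atLeast0)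
  qed
  define s where "s = (\<Sum>i<r. q $ i)"
  define c where "c = s / r"
  define p where "p i = q $ i - c" for i
  define N where "N = (\<Sum>i<r. (p i)\<^sup>2)"
  have N: "0 \<le> N" by (simp add: N_def sum_nonneg)
  have sum_p: "(\<Sum>i<r. p i) = 0"
    using r by (simp add: p_def c_def s_def sum_subtractf)
  have qp: "q $ i = p i + c" for i by (simp add: p_def)
  have "(\<Sum>i<r. (q $ i)\<^sup>2) = (\<Sum>i<r. (p i)\<^sup>2 + 2 * c * p i + c\<^sup>2)"
    by (intro sum.cong) (auto simp: qp power2_eq_square algebra_simps)
  also have "\<dots> = N + s\<^sup>2 / r"
    using r by (simp add: sum.distrib sum_distrib_left[symmetric] sum_p N_def)
      (simp add: c_def power2_eq_square)
  finally have norm_q: "(vnorm q)\<^sup>2 = N + s\<^sup>2 / r" by (simp add: vnorm_power2[OF q])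
  \<comment> \<open>For nonzero \<open>N\<close> this solves (r - 1) (r + t^2 N) = r^2, which puts
    \<open>x\<close> on the boundary of the cone. For \<open>N = 0\<close> division by zero gives
    \<open>t = 0\<close>, hence only an inequality in \<open>tN\<close>.\<close>
  define t where "t = sqrt (r / ((r - 1) * N))"
  have tN: "(real r - 1) * (t\<^sup>2 * N) \<le> r"
    using r N by (cases "N = 0") (auto simp: t_def field_simps)
  have t0: "0 \<le> t" using r N by (simp add: t_def)
  define x where "x = vec r (\<lambda>i. 1 - t * p i)"
  have x: "x \<in> carrier_vec r" by (simp add: x_def)
  have sum_x: "ones r \<bullet> x = r"
    by (simp add: ones_scalar_prod[OF x]) (simp add: x_def sum_subtractf sum_distrib_left[symmetric] sum_p)
  have "(vnorm x)\<^sup>2 = (\<Sum>i<r. 1 - 2 * t * p i + t\<^sup>2 * (p i)\<^sup>2)"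
    unfolding vnorm_power2[OF x]
    by (intro sum.cong) (auto simp: x_def power2_eq_square algebra_simps)
  also have "\<dots> = r + t\<^sup>2 * N"
    by (simp add: sum.distrib sum_subtractf sum_distrib_left[symmetric] sum_p N_def)
  finally have "(real r - 1) * (vnorm x)\<^sup>2 \<le> (real r)\<^sup>2"
    using tN by (simp add: power2_eq_square algebra_simps)
  then have "(sqrt (real r - 1) * vnorm x)\<^sup>2 \<le> (real r)\<^sup>2"
    using r by (simp add: power_mult_distrib)
  then have "sqrt (real r - 1) * vnorm x \<le> ones r \<bullet> x"
    unfolding sum_x by (rule power2_le_imp_le) simp
  from dual[OF x this] have "0 \<le> (\<Sum>i<r. (1 - t * p i) * q $ i)"
    by (simp add: x_def)
  also have "\<dots> = (\<Sum>i<r. q $ i - t * (p i)\<^sup>2 - t * c * p i)"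
    by (intro sum.cong) (auto simp: qp power2_eq_square algebra_simps)
  also have "\<dots> = s - t * N"
    by (simp add: sum_subtractf sum_distrib_left[symmetric] sum_p N_def s_def)
  finally have tNs: "t * N \<le> s" by simp
  have s0: "0 \<le> s" using tNs t0 N by (meson mult_nonneg_nonneg order_trans)
  \<comment> \<open>Obtained by squaring \<open>t * N \<le> s\<close> and inserting
    \<open>t\<close>. Given \<open>norm_q\<close>, this is the claimed norm bound in squared
    form.\<close>
  have "r * N \<le> (real r - 1) * s\<^sup>2"
  proof (cases "N = 0")
    case True
    then show ?thesis using r by simp
  next
    case False
    have "(t * N)\<^sup>2 \<le> s\<^sup>2" using tNs t0 N by (intro power_mono) auto
    moreover have "(real r - 1) * (t * N)\<^sup>2 = r * N"
      using False r N by (simp add: t_def power_mult_distrib power2_eq_square field_simps)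
    ultimately show ?thesis
      using mult_left_mono[of "(t * N)\<^sup>2" "s\<^sup>2" "real r - 1"] r by simp
  qed
  then have "N + s\<^sup>2 / r \<le> s\<^sup>2" using r by (simp add: field_simps)
  then have "vnorm q \<le> s"
    using norm_q s0 by (metis power2_le_imp_le)
  then show ?thesis by (simp add: s_def ones_scalar_prod[OF q])
qed

text \<open>Both \<open>q\<close> and \<open>- q\<close> have nonnegative image, so the norm of each
  is bounded by its entry sum. These sums are opposite, hence both norms vanish.\<close>

lemma SSC_inj:
  assumes "satisfies_SSC H" "H \<in> carrier_mat m r" "q \<in> carrier_vec r" "H *\<^sub>v q = 0\<^sub>v m"
  shows "q = 0\<^sub>v r"
proof -
  have "H *\<^sub>v (- q) = 0\<^sub>v m"
  proof -
    have "- q = (- 1) \<cdot>\<^sub>v q" by auto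
    then show ?thesis using mult_mat_vec[OF assms(2,3), of "- 1"] assms(4) by auto
  qed
  then have "vnorm (- q) \<le> ones r \<bullet> (- q)"
    using assms by (intro SSC_nonneg_imp_vnorm_le[of H m]) auto
  moreover have "ones r \<bullet> (- q) = - (ones r \<bullet> q)"
    using assms(3) by (simp add: ones_def)
  moreover have "vnorm q \<le> ones r \<bullet> q"
    using assms by (intro SSC_nonneg_imp_vnorm_le[of H m]) auto
  ultimately have "vnorm q = 0"
    using vnorm_nonneg[of q] vnorm_nonneg[of "- q"] by simp
  then have "(\<Sum>i<r. (q $ i)\<^sup>2) = 0"
    using vnorm_power2[OF assms(3)] by simp
  then show ?thesis
    using assms(3) by (intro eq_vecI) (auto simp: sum_nonneg_eq_0_iff)
qed

text \<open>A left inverse maps columns \<open>b\<close> and \<open>b'\<close> to unit vectors.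
  Distinctness of the columns of a Kronecker product is what later separates index tuples.\<close>

lemma SSC_col_inj:
  assumes "satisfies_SSC H" "H \<in> carrier_mat m r" "b < r" "b' < r" "col H b = col H b'"
  shows "b = b'"
proof (rule ccontr)
  assume ne: "b \<noteq> b'"
  obtain L where L: "L \<in> carrier_mat r m" "L * H = 1\<^sub>m r"
    using left_inverse_exists[OF assms(2)] SSC_inj[OF assms(1,2)] by blast
  have "col (L * H) b = col (L * H) b'"
    using L(1) assms by simp
  then have "unit_vec r b = (unit_vec r b' :: real vec)" using L(2) assms by simp
  then show False using ne assms by simp
qed

text \<open>As \<open>q\<close> lies in the cone, it remains to see that it is not interior. Moving
  a little against the all-ones vector leaves the cone, because for \<open>r\<close> at least 2 the
  entry sum falls faster than the norm.\<close>

lemma frontier_dual_ice_cream_cone: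
  assumes q: "q \<in> carrier_vec r" and r: "2 \<le> r" and pos: "0 < ones r \<bullet> q"
    and eq: "vnorm q = ones r \<bullet> q"
  shows "q \<in> euclidean_vec_topology r frontier_of dual_ice_cream_cone r"
proof -
  interpret Metric_space "carrier_vec r" "vdist r" by (rule Metric_space_vdist)
  let ?X = "euclidean_vec_topology r" and ?C = "dual_ice_cream_cone r"
  have X: "?X = mtopology" by (simp add: euclidean_vec_topology_def)
  have qC: "q \<in> ?C" using q eq by (simp add: dual_ice_cream_cone_def)
  have "?C \<subseteq> topspace ?X" unfolding X dual_ice_cream_cone_def topspace_mtopology by blast
  then have "q \<in> ?X closure_of ?C" using qC by (rule subsetD[OF closure_of_subset])
  moreover have "q \<notin> ?X interior_of ?C"
  proof
    assume "q \<in> ?X interior_of ?C"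
    then obtain V where V: "openin mtopology V" "q \<in> V" "V \<subseteq> ?C"
      unfolding interior_of_def X by blast
    then obtain \<delta> where "\<delta> > 0" "mball q \<delta> \<subseteq> V"
      unfolding openin_mtopology by meson
    then have \<delta>: "\<delta> > 0" "mball q \<delta> \<subseteq> ?C"
      using V(3) by simp_all
    define s where "s = ones r \<bullet> q"
    \<comment> \<open>The shifted point is at distance \<open>sqrt r * \<epsilon>\<close>, so the
      first bound keeps it in the ball; the second keeps its entry sum nonnegative.\<close>
    define \<epsilon> where "\<epsilon> = min (\<delta> / (2 * sqrt r)) (s / r)"
    have \<epsilon>: "0 < \<epsilon>" "\<epsilon> \<le> s / r" "\<epsilon> \<le> \<delta> / (2 * sqrt r)"
      using \<delta>(1) pos r by (auto simp: \<epsilon>_def s_def)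
    define x where "x = vec r (\<lambda>i. q $ i - \<epsilon>)"
    have x: "x \<in> carrier_vec r" by (simp add: x_def)
    have "vdist r q x = sqrt (real r) * \<epsilon>"
      using \<epsilon>(1) by (simp add: vdist_def L2_set_def x_def real_sqrt_mult)
    also have "\<dots> \<le> sqrt r * (\<delta> / (2 * sqrt r))" using \<epsilon>(3) by (intro mult_left_mono) auto
    also have "\<dots> = \<delta> / 2" using r by simp
    also have "\<dots> < \<delta>" using \<delta>(1) by simp
    finally have "x \<in> mball q \<delta>" using q x by (simp add: in_mball)
    then have "x \<in> ?C" by (rule subsetD[OF \<delta>(2)])
    then have le: "vnorm x \<le> ones r \<bullet> x" by (simp add: dual_ice_cream_cone_def)
    have sum_x: "ones r \<bullet> x = s - r * \<epsilon>"
      by (simp add: ones_scalar_prod[OF x] s_def ones_scalar_prod[OF q])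
        (simp add: x_def sum_subtractf)
    have "(vnorm x)\<^sup>2 = (\<Sum>i<r. (q $ i)\<^sup>2 - 2 * \<epsilon> * q $ i + \<epsilon>\<^sup>2)"
      unfolding vnorm_power2[OF x]
      by (intro sum.cong) (auto simp: x_def power2_eq_square algebra_simps)
    also have "\<dots> = s\<^sup>2 - 2 * \<epsilon> * s + r * \<epsilon>\<^sup>2"
      using eq vnorm_power2[OF q] ones_scalar_prod[OF q]
      by (simp add: sum.distrib sum_subtractf sum_distrib_left[symmetric] s_def)
    finally have norm_x: "(vnorm x)\<^sup>2 = s\<^sup>2 - 2 * \<epsilon> * s + r * \<epsilon>\<^sup>2" .
    have "(vnorm x)\<^sup>2 \<le> (s - r * \<epsilon>)\<^sup>2"
      using power_mono[OF le vnorm_nonneg, of 2] unfolding sum_x .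
    \<comment> \<open>The squared norm minus the squared entry sum factors. Membership in the cone
      makes it nonpositive, while all three factors are positive.\<close>
    moreover have "(real r - 1) * \<epsilon> * (2 * s - r * \<epsilon>)
        = (s\<^sup>2 - 2 * \<epsilon> * s + r * \<epsilon>\<^sup>2) - (s - r * \<epsilon>)\<^sup>2"
      by (simp add: power2_eq_square algebra_simps)
    ultimately have "(real r - 1) * \<epsilon> * (2 * s - r * \<epsilon>) \<le> 0"
      unfolding norm_x by simp
    moreover have "r * \<epsilon> \<le> s" using \<epsilon>(2) r by (simp add: field_simps)
    then have "0 < (real r - 1) * \<epsilon> * (2 * s - r * \<epsilon>)"
      using \<epsilon>(1) r pos by (intro mult_pos_pos) (auto simp: s_def)
    ultimately show False by simp
  qed
  ultimately show ?thesis by (simp add: frontier_of_def)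
qed

text \<open>\<open>H q\<close> nonnegative means membership in the dual cone, and norm equal to
  entry sum means the boundary. SSC2 leaves a multiple of a unit vector, and the sum 1 fixes the
  multiple.\<close>

lemma SSC_unit_vec:
  assumes ssc: "satisfies_SSC H" and H: "H \<in> carrier_mat m r" and q: "q \<in> carrier_vec r"
    and Hq: "0\<^sub>v m \<le> H *\<^sub>v q" and sum: "ones r \<bullet> q = 1" and norm: "vnorm q = 1"
  shows "\<exists>k<r. q = unit_vec r k"
proof -
  note r = satisfies_SSC_D(1)[OF ssc H] and eq = satisfies_SSC_D(4)[OF ssc H]
  have "q \<in> dual_cone (transpose_mat H)" using q Hq H by (simp add: dual_cone_def)
  moreover have "q \<in> euclidean_vec_topology r frontier_of dual_ice_cream_cone r"
    using frontier_dual_ice_cream_cone[OF q r] sum norm by simp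
  ultimately obtain c k where ck: "q = c \<cdot>\<^sub>v unit_vec r k" "k < r" using eq by blast
  have "c = 1"
    using sum ck by (simp add: ones_def)
  then show ?thesis using ck by auto
qed

subsection \<open>Permutation matrices\<close>

text \<open>Carries the permutation hidden in \<open>permutation_matrix\<close> explicitly. In this
  convention right multiplication puts column \<open>p b\<close> in place of column
  \<open>b\<close>.\<close>

definition perm_mat :: "nat \<Rightarrow> (nat \<Rightarrow> nat) \<Rightarrow> real mat" where
  "perm_mat r p = mat r r (\<lambda>(i, j). if i = p j then 1 else 0)"

lemma perm_mat_carrier [simp]: "perm_mat r p \<in> carrier_mat r r"
  by (simp add: perm_mat_def)

lemma perm_mat_dim [simp]: "dim_row (perm_mat r p) = r" "dim_col (perm_mat r p) = r"
  by (simp_all add: perm_mat_def)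

lemma mult_perm_mat_index:
  assumes "M \<in> carrier_mat m r" "p permutes {..<r}" "a < m" "b < r"
  shows "(M * perm_mat r p) $$ (a, b) = M $$ (a, p b)"
proof -
  have "p b < r" using permutes_in_image[OF assms(2), of b] assms(4) by simp
  have "(M * perm_mat r p) $$ (a, b) = (\<Sum>k<r. M $$ (a, k) * perm_mat r p $$ (k, b))"
    using assms by (simp add: scalar_prod_def perm_mat_def lessThan_atLeast0)
  also have "\<dots> = (\<Sum>k<r. if k = p b then M $$ (a, k) else 0)"
    using assms by (intro sum.cong) (auto simp: perm_mat_def)
  finally show ?thesis using \<open>p b < r\<close> by simp
qed

lemma transpose_perm_mat_mult_index:
  assumes "M \<in> carrier_mat r m" "p permutes {..<r}" "a < r" "b < m"
  shows "(transpose_mat (perm_mat r p) * M) $$ (a, b) = M $$ (p a, b)"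
proof -
  have "p a < r" using permutes_in_image[OF assms(2), of a] assms(3) by simp
  have "transpose_mat (perm_mat r p) * M = transpose_mat (transpose_mat M * perm_mat r p)"
    using assms by (simp add: transpose_mult[of "transpose_mat M" m r "perm_mat r p" r])
  then show ?thesis
    using assms \<open>p a < r\<close> mult_perm_mat_index[of "transpose_mat M" m r p b a] by auto
qed

lemma perm_mat_mult_mult_index:
  assumes M: "M \<in> carrier_mat r s" and q: "q permutes {..<r}" and p: "p permutes {..<s}"
    and a: "a < r" and b: "b < s"
  shows "(transpose_mat (perm_mat r q) * M * perm_mat s p) $$ (a, b) = M $$ (q a, p b)"
proof -
  have "p b < s" using permutes_in_image[OF p, of b] b by simp
  moreover have "transpose_mat (perm_mat r q) * M \<in> carrier_mat r s"
    using M by (intro mult_carrier_mat[of _ r r]) auto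
  ultimately show ?thesis
    using mult_perm_mat_index[OF _ p a b] transpose_perm_mat_mult_index[OF M q a] by metis
qed

lemma perm_mat_orthogonal:
  assumes "p permutes {..<r}"
  shows "transpose_mat (perm_mat r p) * perm_mat r p = 1\<^sub>m r"
proof (rule eq_matI)
  fix a b assume ab: "a < dim_row (1\<^sub>m r)" "b < dim_col (1\<^sub>m r)"
  have "p a < r" using permutes_in_image[OF assms, of a] ab by simp
  then show "(transpose_mat (perm_mat r p) * perm_mat r p) $$ (a, b) = 1\<^sub>m r $$ (a, b)"
    using ab assms transpose_perm_mat_mult_index[of "perm_mat r p" r r p a b]
    by (auto simp: perm_mat_def dest: permutes_inj_on injD[OF permutes_inj])
qed (auto simp: perm_mat_def)

text \<open>Two identical columns would annihilate the determinant, so the positions of the ones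
  form an injection of a finite set into itself, that is, a permutation.\<close>

lemma unit_columns_imp_perm_mat:
  fixes Q :: "real mat"
  assumes Q: "Q \<in> carrier_mat r r" and det: "det Q \<noteq> 0"
    and cols: "\<And>j. j < r \<Longrightarrow> \<exists>k<r. col Q j = unit_vec r k"
  shows "\<exists>p. p permutes {..<r} \<and> Q = perm_mat r p"
proof -
  obtain f where f: "\<And>j. j < r \<Longrightarrow> f j < r \<and> col Q j = unit_vec r (f j)"
    using cols by metis
  \<comment> \<open>\<open>permutes\<close> requires the identity outside the index range.\<close>
  define p where "p j = (if j < r then f j else j)" for j
  have "inj_on f {..<r}"
  proof (rule inj_onI, rule ccontr)
    fix i j assume "i \<in> {..<r}" "j \<in> {..<r}" "f i = f j" "i \<noteq> j"
    then have "det Q = 0" using det_identical_columns[OF Q, of i j] f by simp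
    then show False using det by simp
  qed
  then have "inj_on p {..<r}" by (auto simp: inj_on_def p_def)
  moreover have "p ` {..<r} \<subseteq> {..<r}" using f by (auto simp: p_def)
  ultimately have "bij_betw p {..<r} {..<r}"
    by (simp add: bij_betw_def endo_inj_surj)
  then have "p permutes {..<r}" by (rule bij_imp_permutes) (simp add: p_def)
  moreover have "Q = perm_mat r p"
  proof (rule eq_matI)
    fix i j assume "i < dim_row (perm_mat r p)" "j < dim_col (perm_mat r p)"
    then have ij: "i < r" "j < r" by (auto simp: perm_mat_def)
    then have "Q $$ (i, j) = col Q j $ i" using Q by simp
    then show "Q $$ (i, j) = perm_mat r p $$ (i, j)"
      using ij f[of j] by (simp add: perm_mat_def p_def)
  qed (use Q in \<open>auto simp: perm_mat_def\<close>)
  ultimately show ?thesis by blast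
qed

subsection \<open>Factorizations of minimal determinant\<close>

text \<open>Writing e for the all-ones vector: e^T Q = e^T A Q = e^T U = e^T.\<close>

lemma sum_to_one_columns_mult:
  assumes U: "sum_to_one_columns U" "U \<in> carrier_mat m r"
    and A: "sum_to_one_columns A" "A \<in> carrier_mat m r" "U = A * Q" "Q \<in> carrier_mat r r" and j: "j < r"
  shows "ones r \<bullet> col Q j = 1"
proof -
  have c: "col Q j \<in> carrier_vec r" using A(4) by auto
  have o: "ones k \<in> carrier_vec k" for k by (simp add: ones_def)
  have "ones r \<bullet> col Q j = (transpose_mat A *\<^sub>v ones m) \<bullet> col Q j"
    using A by (simp add: sum_to_one_columns_def)
  also have "\<dots> = ones m \<bullet> (A *\<^sub>v col Q j)"
    by (rule transpose_vec_mult_scalar[OF A(2) c o])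
  also have "A *\<^sub>v col Q j = col U j"
    using col_mult2[OF A(2,4) j] A(3) by simp
  also have "ones m \<bullet> \<dots> = col U j \<bullet> ones m"
    by (rule comm_scalar_prod[OF o]) (use U in auto)
  also have "\<dots> = (transpose_mat U *\<^sub>v ones m) $ j"
    using U j by simp
  also have "\<dots> = 1"
    using U j by (simp add: sum_to_one_columns_def ones_def del: index_mult_mat_vec)
  finally show ?thesis .
qed

lemma transpose_mult3:
  fixes A B C :: "real mat"
  assumes "A \<in> carrier_mat m k" "B \<in> carrier_mat k l" "C \<in> carrier_mat l n"
  shows "transpose_mat (A * B * C) = transpose_mat C * transpose_mat B * transpose_mat A"
  using assms
  by (simp add: transpose_mult[of "A * B" m l C n] transpose_mult[of A m k B l]
      assoc_mult_mat[of "transpose_mat C" n l "transpose_mat B" k "transpose_mat A" m]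
      del: assoc_mult_mat)

text \<open>Cancelling \<open>B\<close> on the left and A^T on the right expresses \<open>G\<close>.
  Its invertibility passes to the middle factors, which forces the columns of \<open>UI\<close> into
  the column space of \<open>A\<close>, where \<open>A * LA\<close> acts as the identity.\<close>

lemma factor_through_left_inverses:
  fixes A B UI UJ :: "real mat"
  assumes A: "A \<in> carrier_mat nI r" and B: "B \<in> carrier_mat nJ r" and G: "G \<in> carrier_mat r r"
    and UI: "UI \<in> carrier_mat nI r" and UJ: "UJ \<in> carrier_mat nJ r" and K: "K \<in> carrier_mat r r"
    and LA: "LA \<in> carrier_mat r nI" "LA * A = 1\<^sub>m r"
    and LB: "LB \<in> carrier_mat r nJ" "LB * B = 1\<^sub>m r"
    and eq: "B * G * transpose_mat A = UJ * K * transpose_mat UI" and det: "det G \<noteq> 0"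
  shows "G = (LB * UJ) * K * transpose_mat (LA * UI)" and "UI = A * (LA * UI)"
proof -
  define Q where "Q = LA * UI"
  define R where "R = LB * UJ"
  have QR: "Q \<in> carrier_mat r r" "R \<in> carrier_mat r r" using assms by (auto simp: Q_def R_def)
  have "G * transpose_mat A = LB * (B * G * transpose_mat A)"
  proof -
    have "LB * (B * G * transpose_mat A) = (LB * B) * (G * transpose_mat A)"
      using A B G LB(1)
      by (simp add: assoc_mult_mat[of LB r nJ B r "G * transpose_mat A" nI]
          assoc_mult_mat[of B nJ r G r "transpose_mat A" nI])
    then show ?thesis using LB G A by simp
  qed
  also have "\<dots> = R * K * transpose_mat UI"
    using eq LB UJ K UI
    by (simp add: R_def assoc_mult_mat[of LB r nJ UJ r "K * transpose_mat UI" nI]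
        assoc_mult_mat[of UJ nJ r K r "transpose_mat UI" nI]
        assoc_mult_mat[of LB r nJ UJ r K r]
        assoc_mult_mat[of LB r nJ "UJ * K" r "transpose_mat UI" nI]
        assoc_mult_mat[of "LB * UJ" r r K r "transpose_mat UI" nI])
  finally have GA: "G * transpose_mat A = R * K * transpose_mat UI" .
  have tA: "transpose_mat A * transpose_mat LA = 1\<^sub>m r"
    using LA A by (simp add: transpose_mult[of LA r nI A r, symmetric])
  have "G = G * (transpose_mat A * transpose_mat LA)" using tA G by simp
  also have "\<dots> = (G * transpose_mat A) * transpose_mat LA"
    using G A LA by (simp add: assoc_mult_mat[of G r r "transpose_mat A" nI "transpose_mat LA" r])
  also have "\<dots> = R * K * (transpose_mat UI * transpose_mat LA)"
    unfolding GA using QR K UI LA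
    by (intro assoc_mult_mat[of _ r r _ nI _ r]) auto
  also have "transpose_mat UI * transpose_mat LA = transpose_mat Q"
    using LA UI by (simp add: Q_def transpose_mult[of LA r nI UI r])
  finally show G': "G = (LB * UJ) * K * transpose_mat (LA * UI)" by (simp add: Q_def R_def)
  \<comment> \<open>Hence \<open>GA\<close> can be solved for the transpose of \<open>UI\<close>,
    exhibiting \<open>UI\<close> as \<open>A\<close> times some matrix.\<close>
  have "det (R * K) \<noteq> 0"
    using det G' QR K by (auto simp: Q_def[symmetric] R_def[symmetric] det_mult[of _ r])
  then obtain W where W: "W \<in> carrier_mat r r" "W * (R * K) = 1\<^sub>m r"
    using det_non_zero_imp_unit[of "R * K" r undefined] QR K by (auto simp: Units_def ring_mat_def)
  have "transpose_mat UI = W * (R * K) * transpose_mat UI" using W UI by simp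
  also have "\<dots> = W * (G * transpose_mat A)"
    unfolding GA using W QR K UI by (intro assoc_mult_mat[of _ r r _ r _ nI]) auto
  also have "\<dots> = (W * G) * transpose_mat A"
    using W G A by (simp add: assoc_mult_mat[of W r r G r "transpose_mat A" nI])
  finally have "transpose_mat (transpose_mat UI) = transpose_mat ((W * G) * transpose_mat A)" by simp
  then have UIA: "UI = A * transpose_mat (W * G)"
    using W G A transpose_mult[of "W * G" r r "transpose_mat A" nI] by (simp del: assoc_mult_mat)
  \<comment> \<open>Applying \<open>LA\<close> identifies that matrix as \<open>Q\<close>.\<close>
  have "Q = (LA * A) * transpose_mat (W * G)"
    unfolding Q_def UIA using LA A W G
    by (intro assoc_mult_mat[symmetric, of _ r nI _ r _ r]) auto
  also have "\<dots> = transpose_mat (W * G)" using LA W G by simp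
  finally show "UI = A * (LA * UI)" using UIA by (simp add: Q_def)
qed

text \<open>By SSC1 every column norm is at most 1, so Hadamard's inequality bounds the determinant.
  In the equality case factors in [0,1] have product at least 1, hence are all 1, and SSC2 applies
  to every column.\<close>

lemma SSC_det_le_1:
  assumes ssc: "satisfies_SSC A" and A: "A \<in> carrier_mat m r" and Q: "Q \<in> carrier_mat r r"
    and nonneg: "0\<^sub>m m r \<le> A * Q" and sum: "\<And>j. j < r \<Longrightarrow> ones r \<bullet> col Q j = 1"
  shows "\<bar>det Q\<bar> \<le> 1"
    and "\<bar>det Q\<bar> = 1 \<Longrightarrow> \<exists>p. p permutes {..<r} \<and> Q = perm_mat r p"
proof -
  have c: "col Q j \<in> carrier_vec r" for j using Q by auto
  have pos: "0\<^sub>v m \<le> A *\<^sub>v col Q j" if "j < r" for j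
    using that nonneg A Q by (auto simp: less_eq_mat_def less_eq_vec_def)
  define N where "N j = (\<Sum>i<r. (Q $$ (i, j))\<^sup>2)" for j
  have N: "N j = (vnorm (col Q j))\<^sup>2" if "j < r" for j
    using that Q by (simp add: vnorm_power2[OF c] N_def)
  have N1: "0 \<le> N j \<and> N j \<le> 1" if "j < r" for j
  proof -
    have "vnorm (col Q j) \<le> 1"
      using SSC_nonneg_imp_vnorm_le[OF ssc A c pos] sum that by simp
    then show ?thesis using N[OF that] vnorm_nonneg[of "col Q j"] by (simp add: power_le_one)
  qed
  have had: "(det Q)\<^sup>2 \<le> (\<Prod>j<r. N j)"
    using hadamard_inequality[OF Q] by (simp add: N_def)
  also have "\<dots> \<le> 1" using N1 by (intro prod_le_1) auto
  finally show "\<bar>det Q\<bar> \<le> 1" by (simp add: abs_square_le_1)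
  assume det: "\<bar>det Q\<bar> = 1"
  have "(det Q)\<^sup>2 = 1" using det by (simp add: power2_eq_1_iff abs_if split: if_splits)
  have "N j = 1" if j: "j < r" for j
  proof -
    have "1 \<le> (\<Prod>j<r. N j)" using had \<open>(det Q)\<^sup>2 = 1\<close> by simp
    also have "\<dots> = N j * (\<Prod>j\<in>{..<r} - {j}. N j)"
      using j by (intro prod.remove) auto
    also have "\<dots> \<le> N j * 1"
      using N1 j by (intro mult_left_mono prod_le_1) auto
    finally show ?thesis using N1[OF j] by simp
  qed
  then have norm: "vnorm (col Q j) = 1" if "j < r" for j
    using N[OF that] that vnorm_nonneg[of "col Q j"] by (simp add: power2_eq_1_iff)
  show "\<exists>p. p permutes {..<r} \<and> Q = perm_mat r p"
  proof (rule unit_columns_imp_perm_mat[OF Q])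
    show "det Q \<noteq> 0" using det by auto
    show "\<exists>k<r. col Q j = unit_vec r k" if "j < r" for j
      using SSC_unit_vec[OF ssc A c pos sum norm] that by simp
  qed
qed

theorem SSC_min_det_factorization_unique:
  assumes A: "A \<in> carrier_mat nI r" "satisfies_SSC A" "sum_to_one_columns A"
    and B: "B \<in> carrier_mat nJ r" "satisfies_SSC B" "sum_to_one_columns B"
    and G: "G \<in> carrier_mat r r" "det G \<noteq> 0"
    and opt: "optimal_solution nI nJ r r (B * G * transpose_mat A) UI UJ K"
  obtains p q where "p permutes {..<r}" "q permutes {..<r}" "UI = A * perm_mat r p"
    "UJ = B * perm_mat r q" "K = transpose_mat (perm_mat r q) * G * perm_mat r p"
proof -
  have f: "UI \<in> carrier_mat nI r" "UJ \<in> carrier_mat nJ r" "K \<in> carrier_mat r r"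
    "B * G * transpose_mat A = UJ * K * transpose_mat UI"
    "sum_to_one_columns UI" "sum_to_one_columns UJ" "0\<^sub>m nI r \<le> UI" "0\<^sub>m nJ r \<le> UJ"
    using opt by (auto simp: optimal_solution_def feasible_def)
  \<comment> \<open>The true factors compete in the minimization, which caps |det K|.\<close>
  have "feasible nI nJ r r (B * G * transpose_mat A) A B G"
    using A B G satisfies_SSC_D(2)[OF A(2,1)] satisfies_SSC_D(2)[OF B(2,1)] by (simp add: feasible_def)
  then have le: "\<bar>det K\<bar> \<le> \<bar>det G\<bar>" using opt by (auto simp: optimal_solution_def)
  obtain LA where LA: "LA \<in> carrier_mat r nI" "LA * A = 1\<^sub>m r"
    using left_inverse_exists[OF A(1)] SSC_inj[OF A(2,1)] by blast
  obtain LB where LB: "LB \<in> carrier_mat r nJ" "LB * B = 1\<^sub>m r"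
    using left_inverse_exists[OF B(1)] SSC_inj[OF B(2,1)] by blast
  define P where "P = LA * UI"
  define Q where "Q = LB * UJ"
  have PQ: "P \<in> carrier_mat r r" "Q \<in> carrier_mat r r"
    using f LA LB by (auto simp: P_def Q_def)
  note fac = factor_through_left_inverses[OF A(1) B(1) G(1) f(1,2,3) LA LB f(4) G(2), folded P_def Q_def]
  \<comment> \<open>Transposition swaps the roles of the two factors, so the same lemma also yields
    \<open>UJ\<close>.\<close>
  have tr: "A * transpose_mat G * transpose_mat B = UI * transpose_mat K * transpose_mat UJ"
  proof -
    have "transpose_mat (B * G * transpose_mat A) = A * transpose_mat G * transpose_mat B"
      using transpose_mult3[OF B(1) G(1), of "transpose_mat A" nI] A by simp
    moreover have "transpose_mat (UJ * K * transpose_mat UI) = UI * transpose_mat K * transpose_mat UJ"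
      using transpose_mult3[OF f(2,3), of "transpose_mat UI" nI] f(1) by simp
    ultimately show ?thesis using f(4) by simp
  qed
  have UJ: "UJ = B * Q"
    using factor_through_left_inverses(2)[OF B(1) A(1) _ f(2,1) _ LB LA tr] G f(3)
    by (simp add: det_transpose Q_def)
  have sP: "ones r \<bullet> col P j = 1" if "j < r" for j
    using sum_to_one_columns_mult[OF f(5,1) A(3,1) fac(2) PQ(1) that] .
  have sQ: "ones r \<bullet> col Q j = 1" if "j < r" for j
    using sum_to_one_columns_mult[OF f(6,2) B(3,1) UJ PQ(2) that] .
  note dP = SSC_det_le_1[OF A(2,1) PQ(1) f(7)[unfolded fac(2)] sP]
  note dQ = SSC_det_le_1[OF B(2,1) PQ(2) f(8)[unfolded UJ] sQ]
  have det: "\<bar>det G\<bar> = \<bar>det Q\<bar> * \<bar>det K\<bar> * \<bar>det P\<bar>"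
    using PQ f(3) by (subst fac(1)) (simp add: det_mult[of _ r] det_transpose abs_mult)
  \<comment> \<open>A product below 1 would make |det G| smaller than |det K|, which is nonzero
    because det G is.\<close>
  have prod: "1 \<le> \<bar>det Q\<bar> * \<bar>det P\<bar>"
  proof (rule ccontr)
    assume "\<not> 1 \<le> \<bar>det Q\<bar> * \<bar>det P\<bar>"
    moreover have "0 < \<bar>det K\<bar>" using det G(2) by auto
    ultimately have "\<bar>det K\<bar> * (\<bar>det Q\<bar> * \<bar>det P\<bar>) < \<bar>det K\<bar>" by simp
    then show False using det le by (simp add: mult_ac)
  qed
  have "\<bar>det Q\<bar> * \<bar>det P\<bar> \<le> \<bar>det Q\<bar>" "\<bar>det Q\<bar> * \<bar>det P\<bar> \<le> \<bar>det P\<bar>"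
    using dP(1) dQ(1) by (auto simp: mult_left_le mult_left_le_one_le)
  then have "\<bar>det P\<bar> = 1" "\<bar>det Q\<bar> = 1" using prod dP(1) dQ(1) by linarith+
  then obtain p q where p: "p permutes {..<r}" "P = perm_mat r p"
    and q: "q permutes {..<r}" "Q = perm_mat r q"
    using dP(2) dQ(2) by blast
  have oP: "transpose_mat P * P = 1\<^sub>m r" and oQ: "transpose_mat Q * Q = 1\<^sub>m r"
    using p q perm_mat_orthogonal by auto
  have "transpose_mat Q * G * P = transpose_mat Q * (Q * (K * (transpose_mat P * P)))"
    using PQ f(3) by (subst fac(1))
      (simp add: assoc_mult_mat[of _ r r _ r _ r])
  also have "\<dots> = (transpose_mat Q * Q) * K"
    using PQ f(3) unfolding oP by (simp add: assoc_mult_mat[of "transpose_mat Q" r r _ r _ r])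
  also have "\<dots> = K" using f(3) oQ by simp
  finally have "K = transpose_mat (perm_mat r q) * G * perm_mat r p" using p q by simp
  then show ?thesis using that p q fac(2) UJ by blast
qed

subsection \<open>Kronecker products\<close>

lemma finite_tuples: "finite S \<Longrightarrow> finite (tuples S m)"
  by (simp add: tuples_def finite_PiE)

lemma card_tuples: "finite S \<Longrightarrow> card (tuples S m) = (\<Prod>j\<in>S. m j)"
  by (simp add: tuples_def card_PiE)

lemma tuples_cong: "(\<And>j. j \<in> S \<Longrightarrow> m j = m' j) \<Longrightarrow> tuples S m = tuples S m'"
  unfolding tuples_def by (rule PiE_cong) simp

lemma tuples_D: "i \<in> tuples S r \<Longrightarrow> t \<in> S \<Longrightarrow> i t < r t"
  by (auto simp: tuples_def)

lemma tuple_ordering_bij: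
  assumes "tuple_ordering enum" "finite S"
  shows "bij_betw (enum (tuples S m)) {..<\<Prod>j\<in>S. m j} (tuples S m)"
  using assms finite_tuples[of S m] card_tuples[of S m] by (auto simp: tuple_ordering_def)

lemma kronecker_carrier:
  assumes "\<And>j. j \<in> S \<Longrightarrow> U j \<in> carrier_mat (n j) (r j)"
  shows "kronecker enum S U \<in> carrier_mat (\<Prod>j\<in>S. n j) (\<Prod>j\<in>S. r j)"
proof -
  have "(\<Prod>j\<in>S. dim_row (U j)) = (\<Prod>j\<in>S. n j)" "(\<Prod>j\<in>S. dim_col (U j)) = (\<Prod>j\<in>S. r j)"
    using assms by (auto intro!: prod.cong)
  then show ?thesis by (simp add: kronecker_def Let_def)
qed

lemma kronecker_index:
  assumes "\<And>j. j \<in> S \<Longrightarrow> U j \<in> carrier_mat (n j) (r j)"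
    and "a < (\<Prod>j\<in>S. n j)" "b < (\<Prod>j\<in>S. r j)"
  shows "kronecker enum S U $$ (a, b)
    = (\<Prod>j\<in>S. U j $$ (enum (tuples S n) a j, enum (tuples S r) b j))"
proof -
  have "(\<Prod>j\<in>S. dim_row (U j)) = (\<Prod>j\<in>S. n j)" "(\<Prod>j\<in>S. dim_col (U j)) = (\<Prod>j\<in>S. r j)"
    "tuples S (\<lambda>j. dim_row (U j)) = tuples S n" "tuples S (\<lambda>j. dim_col (U j)) = tuples S r"
    using assms(1) by (auto intro!: prod.cong tuples_cong)
  then show ?thesis using assms(2,3) by (simp add: kronecker_def Let_def)
qed

lemma sum_to_one_columns_iff:
  assumes "U \<in> carrier_mat m r"
  shows "sum_to_one_columns U \<longleftrightarrow> (\<forall>j<r. (\<Sum>i<m. U $$ (i, j)) = 1)"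
proof -
  have "(transpose_mat U *\<^sub>v ones m) $ j = (\<Sum>i<m. U $$ (i, j))" if "j < r" for j
    using that assms by (simp add: scalar_prod_def ones_def lessThan_atLeast0)
  moreover have "transpose_mat U *\<^sub>v ones m = ones r
      \<longleftrightarrow> (\<forall>j<r. (transpose_mat U *\<^sub>v ones m) $ j = 1)"
    using assms by (auto simp: ones_def vec_eq_iff simp del: index_mult_mat_vec)
  ultimately show ?thesis using assms by (simp add: sum_to_one_columns_def)
qed

text \<open>Summing a column over all row tuples factors, by distributivity, into the column sums of
  the individual matrices.\<close>

lemma kronecker_sum_to_one_columns:
  assumes ord: "tuple_ordering enum" and S: "finite S"
    and U: "\<And>j. j \<in> S \<Longrightarrow> U j \<in> carrier_mat (n j) (r j) \<and> sum_to_one_columns (U j)"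
  shows "sum_to_one_columns (kronecker enum S U)"
proof -
  have c: "\<And>j. j \<in> S \<Longrightarrow> U j \<in> carrier_mat (n j) (r j)" using U by blast
  have "(\<Sum>a<\<Prod>j\<in>S. n j. kronecker enum S U $$ (a, b)) = 1" if b: "b < (\<Prod>j\<in>S. r j)" for b
  proof -
    define i where "i = enum (tuples S r) b"
    have i: "i \<in> tuples S r"
      using bij_betwE[OF tuple_ordering_bij[OF ord S, of r]] b by (simp add: i_def)
    have "(\<Sum>a<\<Prod>j\<in>S. n j. kronecker enum S U $$ (a, b))
        = (\<Sum>a<\<Prod>j\<in>S. n j. \<Prod>j\<in>S. U j $$ (enum (tuples S n) a j, i j))"
      using b by (intro sum.cong) (auto simp: kronecker_index[of S U n r, OF c] i_def)
    also have "\<dots> = (\<Sum>k\<in>tuples S n. \<Prod>j\<in>S. U j $$ (k j, i j))"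
      by (rule sum.reindex_bij_betw[OF tuple_ordering_bij[OF ord S]])
    also have "\<dots> = (\<Prod>j\<in>S. \<Sum>k<n j. U j $$ (k, i j))"
      unfolding tuples_def by (rule prod_sum_PiE[symmetric]) (use S in auto)
    also have "\<dots> = 1"
      using U sum_to_one_columns_iff[OF c] tuples_D[OF i] by (intro prod.neutral) blast
    finally show ?thesis .
  qed
  then show ?thesis by (simp add: sum_to_one_columns_iff[OF kronecker_carrier[of S U n r, OF c]])
qed

section \<open>Marginals, and the coordinatewise action of column permutations\<close>

lemma tuples_update: "i \<in> tuples S r \<Longrightarrow> t \<in> S \<Longrightarrow> a < r t \<Longrightarrow> i(t := a) \<in> tuples S r"
  by (auto simp: tuples_def PiE_def Pi_def extensional_def)

text \<open>Fixing one coordinate leaves a product set, so the sum still factors, and every other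
  coordinate contributes 1. This reads a single factor off a Kronecker product.\<close>

lemma sum_prod_tuples_marginal:
  fixes f :: "nat \<Rightarrow> nat \<Rightarrow> real"
  assumes S: "finite S" and t: "t \<in> S" and k: "k < n t"
    and one: "\<And>j. j \<in> S \<Longrightarrow> (\<Sum>a<n j. f j a) = 1"
  shows "(\<Sum>x\<in>{x \<in> tuples S n. x t = k}. \<Prod>j\<in>S. f j (x j)) = f t k"
proof -
  have "{x \<in> tuples S n. x t = k} = (\<Pi>\<^sub>E j\<in>S. if j = t then {k} else {..<n j})"
    using t k by (auto simp: tuples_def PiE_def Pi_def split: if_splits)
  then have "(\<Sum>x\<in>{x \<in> tuples S n. x t = k}. \<Prod>j\<in>S. f j (x j))
      = (\<Prod>j\<in>S. \<Sum>a\<in>(if j = t then {k} else {..<n j}). f j a)"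
    using S by (simp add: prod_sum_PiE)
  also have "\<dots> = (\<Prod>j\<in>S. if j = t then f t k else 1)"
    using one by (intro prod.cong) auto
  finally show ?thesis using S t by simp
qed

text \<open>Summing \<open>eq\<close> over all coordinates but \<open>t\<close> compares column
  \<open>i t\<close> of \<open>V t\<close> with column \<open>\<pi> i t\<close> of
  \<open>U t\<close>. The columns of \<open>U t\<close> are distinct, so \<open>\<pi> i t\<close>
  depends on \<open>i t\<close> alone; this dependence is \<open>p t\<close>.\<close>

lemma tuple_permutation_factors:
  fixes U V :: "nat \<Rightarrow> nat \<Rightarrow> nat \<Rightarrow> real"
  assumes S: "finite S" and ne: "tuples S r \<noteq> {}"
    and U1: "\<And>j i. j \<in> S \<Longrightarrow> i < r j \<Longrightarrow> (\<Sum>a<n j. U j a i) = 1"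
    and V1: "\<And>j i. j \<in> S \<Longrightarrow> i < r j \<Longrightarrow> (\<Sum>a<n j. V j a i) = 1"
    and \<pi>: "bij_betw \<pi> (tuples S r) (tuples S r)"
    and eq: "\<And>k i. k \<in> tuples S n \<Longrightarrow> i \<in> tuples S r \<Longrightarrow>
      (\<Prod>j\<in>S. V j (k j) (i j)) = (\<Prod>j\<in>S. U j (k j) (\<pi> i j))"
    and inj: "\<And>i i'. i \<in> tuples S r \<Longrightarrow> i' \<in> tuples S r \<Longrightarrow>
      (\<And>k. k \<in> tuples S n \<Longrightarrow> (\<Prod>j\<in>S. U j (k j) (i j)) = (\<Prod>j\<in>S. U j (k j) (i' j))) \<Longrightarrow> i = i'"
  obtains p where "\<And>t. t \<in> S \<Longrightarrow> p t permutes {..<r t}"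
    "\<And>t k i. t \<in> S \<Longrightarrow> k < n t \<Longrightarrow> i < r t \<Longrightarrow> V t k i = U t k (p t i)"
    "\<And>i t. i \<in> tuples S r \<Longrightarrow> t \<in> S \<Longrightarrow> \<pi> i t = p t (i t)"
proof -
  \<comment> \<open>A base tuple: single indices are turned into tuples by overwriting one
    coordinate of \<open>w\<close>.\<close>
  obtain w where w: "w \<in> tuples S r" using ne by blast
  have \<pi>t: "\<pi> i \<in> tuples S r" if "i \<in> tuples S r" for i
    using bij_betwE[OF \<pi>] that by blast
  have V: "V t k (i t) = U t k (\<pi> i t)" if i: "i \<in> tuples S r" and t: "t \<in> S" and k: "k < n t" for i t k
  proof -
    have "V t k (i t) = (\<Sum>x\<in>{x \<in> tuples S n. x t = k}. \<Prod>j\<in>S. V j (x j) (i j))"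
      using sum_prod_tuples_marginal[where n = n and f = "\<lambda>j a. V j a (i j)", OF S t k] V1 tuples_D[OF i] by simp
    also have "\<dots> = (\<Sum>x\<in>{x \<in> tuples S n. x t = k}. \<Prod>j\<in>S. U j (x j) (\<pi> i j))"
      using i by (intro sum.cong) (auto simp: eq)
    also have "\<dots> = U t k (\<pi> i t)"
      using sum_prod_tuples_marginal[where n = n and f = "\<lambda>j a. U j a (\<pi> i j)", OF S t k] U1 tuples_D[OF \<pi>t[OF i]]
      by simp
    finally show ?thesis .
  qed
  \<comment> \<open>Equal columns of one factor would give equal product columns at two updates of
    \<open>w\<close>.\<close>
  have U_inj: "a = b" if t: "t \<in> S" and ab: "a < r t" "b < r t" and e: "\<And>k. k < n t \<Longrightarrow> U t k a = U t k b"
    for t a b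
  proof -
    have "w(t := a) = w(t := b)"
    proof (rule inj)
      fix k assume k: "k \<in> tuples S n"
      show "(\<Prod>j\<in>S. U j (k j) ((w(t := a)) j)) = (\<Prod>j\<in>S. U j (k j) ((w(t := b)) j))"
        using e[OF tuples_D[OF k t]] by (intro prod.cong) auto
    qed (use tuples_update w t ab in auto)
    then show ?thesis by (metis fun_upd_same)
  qed
  have comp: "\<pi> i t = \<pi> i' t" if "i \<in> tuples S r" "i' \<in> tuples S r" "t \<in> S" "i t = i' t" for i i' t
  proof (rule U_inj[OF that(3)])
    show "\<pi> i t < r t" using tuples_D[OF \<pi>t[OF that(1)] that(3)] .
    show "\<pi> i' t < r t" using tuples_D[OF \<pi>t[OF that(2)] that(3)] .
    show "U t k (\<pi> i t) = U t k (\<pi> i' t)" if "k < n t" for k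
      using V[OF \<open>i \<in> tuples S r\<close> \<open>t \<in> S\<close> that] V[OF \<open>i' \<in> tuples S r\<close> \<open>t \<in> S\<close> that] \<open>i t = i' t\<close>
      by simp
  qed
  define p where "p t a = (if a < r t then \<pi> (w(t := a)) t else a)" for t a
  have \<pi>p: "\<pi> i t = p t (i t)" if "i \<in> tuples S r" "t \<in> S" for i t
    using comp[of i "w(t := i t)" t] that w tuples_update tuples_D by (simp add: p_def)
  show ?thesis
  proof
    fix t assume t: "t \<in> S"
    \<comment> \<open>Surjectivity comes from a preimage of \<open>w(t := a)\<close> under
      \<open>\<pi>\<close>; injectivity then follows from finiteness.\<close>
    have "{..<r t} \<subseteq> p t ` {..<r t}"
    proof
      fix a assume "a \<in> {..<r t}"
      then have "w(t := a) \<in> tuples S r" using tuples_update[OF w t] by simp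
      then obtain i where i: "i \<in> tuples S r" "\<pi> i = w(t := a)"
        using bij_betw_imp_surj_on[OF \<pi>] by (metis imageE)
      then have "a = p t (i t)" using \<pi>p[OF i(1) t] by simp
      then show "a \<in> p t ` {..<r t}" using tuples_D[OF i(1) t] by blast
    qed
    moreover have "p t ` {..<r t} \<subseteq> {..<r t}"
      using tuples_D[OF \<pi>t[OF tuples_update[OF w t]] t] by (auto simp: p_def)
    ultimately have img: "p t ` {..<r t} = {..<r t}" by simp
    then have "bij_betw (p t) {..<r t} {..<r t}"
      by (simp add: bij_betw_def eq_card_imp_inj_on)
    then show "p t permutes {..<r t}" by (rule bij_imp_permutes) (simp add: p_def)
  next
    fix t k i assume t: "t \<in> S" and k: "k < n t" and i: "i < r t"
    show "V t k i = U t k (p t i)"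
      using V[OF tuples_update[OF w t i] t k] i by (simp add: p_def)
  qed (rule \<pi>p)
qed

text \<open>Transfers the tuple statement to column numbers. The last clause records how
  \<open>\<sigma>\<close> moves tuples, which is needed to permute the core tensor.\<close>

lemma kronecker_column_permutation:
  assumes ord: "tuple_ordering enum" and S: "finite S"
    and U: "\<And>j. j \<in> S \<Longrightarrow> U j \<in> carrier_mat (n j) (r j) \<and> sum_to_one_columns (U j)"
    and V: "\<And>j. j \<in> S \<Longrightarrow> V j \<in> carrier_mat (n j) (r j) \<and> sum_to_one_columns (V j)"
    and \<sigma>: "\<sigma> permutes {..<\<Prod>j\<in>S. r j}" and pos: "0 < (\<Prod>j\<in>S. r j)"
    and eq: "\<And>a b. a < (\<Prod>j\<in>S. n j) \<Longrightarrow> b < (\<Prod>j\<in>S. r j) \<Longrightarrow>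
      kronecker enum S V $$ (a, b) = kronecker enum S U $$ (a, \<sigma> b)"
    and inj: "\<And>b b'. b < (\<Prod>j\<in>S. r j) \<Longrightarrow> b' < (\<Prod>j\<in>S. r j) \<Longrightarrow>
      col (kronecker enum S U) b = col (kronecker enum S U) b' \<Longrightarrow> b = b'"
  shows "\<exists>p. \<forall>t\<in>S. p t permutes {..<r t} \<and> V t = U t * perm_mat (r t) (p t) \<and>
    (\<forall>b<\<Prod>j\<in>S. r j. enum (tuples S r) (\<sigma> b) t = p t (enum (tuples S r) b t))"
proof -
  let ?R = "\<Prod>j\<in>S. r j" and ?N = "\<Prod>j\<in>S. n j"
  let ?e = "enum (tuples S r)" and ?f = "enum (tuples S n)"
  have cU: "\<And>j. j \<in> S \<Longrightarrow> U j \<in> carrier_mat (n j) (r j)" using U by blast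
  have cV: "\<And>j. j \<in> S \<Longrightarrow> V j \<in> carrier_mat (n j) (r j)" using V by blast
  note e = tuple_ordering_bij[OF ord S, of r] and f = tuple_ordering_bij[OF ord S, of n]
  define g where "g = inv_into {..<?R} ?e"
  have g: "bij_betw g (tuples S r) {..<?R}" unfolding g_def by (rule bij_betw_inv_into[OF e])
  have ge: "g (?e b) = b" if "b < ?R" for b
    using bij_betw_inv_into_left[OF e] that by (simp add: g_def)
  have eg: "?e (g i) = i" if "i \<in> tuples S r" for i
    using bij_betw_inv_into_right[OF e] that by (simp add: g_def)
  have gR: "g i < ?R" if "i \<in> tuples S r" for i using bij_betwE[OF g] that by simp
  have \<sigma>R: "\<sigma> b < ?R" if "b < ?R" for b using permutes_in_image[OF \<sigma>, of b] that by simp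
  have fE: "\<exists>a<?N. k = ?f a" if "k \<in> tuples S n" for k
    using bij_betw_imp_surj_on[OF f] that by force
  \<comment> \<open>The column permutation conjugated by the enumeration of the tuples.\<close>
  define \<pi> where "\<pi> = ?e \<circ> (\<sigma> \<circ> g)"
  have \<pi>: "bij_betw \<pi> (tuples S r) (tuples S r)"
    unfolding \<pi>_def by (rule bij_betw_trans[OF bij_betw_trans[OF g permutes_imp_bij[OF \<sigma>]] e])
  have ne: "tuples S r \<noteq> {}"
    using bij_betwE[OF e] pos by auto
  obtain p where p: "\<And>t. t \<in> S \<Longrightarrow> p t permutes {..<r t}"
    and pV: "\<And>t k i. t \<in> S \<Longrightarrow> k < n t \<Longrightarrow> i < r t \<Longrightarrow> V t $$ (k, i) = U t $$ (k, p t i)"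
    and p\<pi>: "\<And>i t. i \<in> tuples S r \<Longrightarrow> t \<in> S \<Longrightarrow> \<pi> i t = p t (i t)"
  proof (rule tuple_permutation_factors[OF S ne, where n = n and \<pi> = \<pi>
        and U = "\<lambda>j k i. U j $$ (k, i)" and V = "\<lambda>j k i. V j $$ (k, i)"])
    show "(\<Sum>a<n j. U j $$ (a, i)) = 1" if "j \<in> S" "i < r j" for j i
      using U[OF that(1)] that(2) by (auto simp: sum_to_one_columns_iff)
    show "(\<Sum>a<n j. V j $$ (a, i)) = 1" if "j \<in> S" "i < r j" for j i
      using V[OF that(1)] that(2) by (auto simp: sum_to_one_columns_iff)
    show "bij_betw \<pi> (tuples S r) (tuples S r)" by (rule \<pi>)
    show "(\<Prod>j\<in>S. V j $$ (k j, i j)) = (\<Prod>j\<in>S. U j $$ (k j, \<pi> i j))"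
      if k: "k \<in> tuples S n" and i: "i \<in> tuples S r" for k i
    proof -
      obtain a where a: "a < ?N" "k = ?f a" using fE[OF k] by blast
      show ?thesis
        using eq[OF a(1) gR[OF i]] kronecker_index[of S V n r _ _ enum, OF cV a(1) gR[OF i]]
          kronecker_index[of S U n r _ _ enum, OF cU a(1) \<sigma>R[OF gR[OF i]]] eg[OF i] a(2)
        by (simp add: \<pi>_def)
    qed
    show "i = i'" if i: "i \<in> tuples S r" and i': "i' \<in> tuples S r"
      and k: "\<And>k. k \<in> tuples S n \<Longrightarrow> (\<Prod>j\<in>S. U j $$ (k j, i j)) = (\<Prod>j\<in>S. U j $$ (k j, i' j))" for i i'
    proof -
      have "col (kronecker enum S U) (g i) = col (kronecker enum S U) (g i')"
      proof (rule eq_vecI)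
        fix a assume "a < dim_vec (col (kronecker enum S U) (g i'))"
        then have a: "a < ?N" using kronecker_carrier[of S U n r enum, OF cU] by simp
        then have "?f a \<in> tuples S n" using bij_betwE[OF f] by simp
        then have "kronecker enum S U $$ (a, g i) = kronecker enum S U $$ (a, g i')"
          using kronecker_index[of S U n r _ _ enum, OF cU a gR[OF i]] kronecker_index[of S U n r _ _ enum, OF cU a gR[OF i']]
            k eg[OF i] eg[OF i'] by simp
        then show "col (kronecker enum S U) (g i) $ a = col (kronecker enum S U) (g i') $ a"
          using a gR[OF i] gR[OF i'] kronecker_carrier[of S U n r enum, OF cU] by simp
      qed simp
      then have "g i = g i'" by (rule inj[OF gR[OF i] gR[OF i']])
      then show ?thesis using eg i i' by metis
    qed
  qed blast
  show ?thesis
  proof (intro exI[of _ p] ballI conjI allI impI)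
    fix t assume t: "t \<in> S"
    show "p t permutes {..<r t}" by (rule p[OF t])
    show "V t = U t * perm_mat (r t) (p t)"
    proof (rule eq_matI)
      fix k i assume "k < dim_row (U t * perm_mat (r t) (p t))" "i < dim_col (U t * perm_mat (r t) (p t))"
      then have "k < n t" "i < r t" using cU[OF t] by auto
      then show "V t $$ (k, i) = (U t * perm_mat (r t) (p t)) $$ (k, i)"
        using pV[OF t] mult_perm_mat_index[OF cU[OF t] p[OF t]] by simp
    qed (use cU[OF t] cV[OF t] in auto)
    fix b assume b: "b < ?R"
    have "?e b \<in> tuples S r" using bij_betwE[OF e] b by simp
    from p\<pi>[OF this t] show "?e (\<sigma> b) t = p t (?e b t)" by (simp add: \<pi>_def ge[OF b])
  qed
qed

subsection \<open>Tensor unfoldings\<close>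

text \<open>A tuple corresponds to its pair of restrictions. Extensionality makes this a bijection,
  since merged tuples are again \<open>undefined\<close> outside \<open>D\<close>.\<close>

lemma sum_tuples_split:
  assumes "I \<subseteq> D"
  shows "(\<Sum>i\<in>tuples D r. F i)
    = (\<Sum>x\<in>tuples (D - I) r. \<Sum>y\<in>tuples I r. F (\<lambda>j. if j \<in> I then y j else x j))"
proof -
  have "(\<Sum>i\<in>tuples D r. F i)
      = (\<Sum>(x, y)\<in>tuples (D - I) r \<times> tuples I r. F (\<lambda>j. if j \<in> I then y j else x j))"
    by (rule sum.reindex_bij_witness[where j = "\<lambda>i. (restrict i (D - I), restrict i I)"
          and i = "\<lambda>(x, y) j. if j \<in> I then y j else x j"])
      (use assms in \<open>auto simp: tuples_def PiE_def Pi_def extensional_def restrict_def fun_eq_iff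
          split: if_splits intro!: arg_cong[of _ _ F]\<close>)
  then show ?thesis by (simp add: sum.cartesian_product)
qed

lemma unfolding_index:
  assumes "a < (\<Prod>j\<in>{1..d} - I. n j)" "b < (\<Prod>j\<in>I. n j)"
  shows "tensor_unfolding enum d n I T $$ (a, b)
    = T (\<lambda>j. if j \<in> I then enum (tuples I n) b j else enum (tuples ({1..d} - I) n) a j)"
  using assms by (simp add: tensor_unfolding_def Let_def del: One_nat_def)

lemma unfolding_carrier [simp]:
  "tensor_unfolding enum d n I T \<in> carrier_mat (\<Prod>j\<in>{1..d} - I. n j) (\<Prod>j\<in>I. n j)"
  by (simp add: tensor_unfolding_def Let_def)

lemma merge_tuples:
  assumes "I \<subseteq> D" "x \<in> tuples (D - I) n" "y \<in> tuples I n"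
  shows "(\<lambda>j. if j \<in> I then y j else x j) \<in> tuples D n"
  using assms by (auto simp: tuples_def PiE_def Pi_def extensional_def)

text \<open>Splitting the summation tuple into its parts over \<open>I\<close> and the complement
  splits the coefficient product into one entry of each Kronecker product, leaving a triple matrix
  product.\<close>

lemma unfolding_multilinear_mult:
  assumes ord: "tuple_ordering enum" and I: "I \<subseteq> {1..d}"
    and U: "\<And>i. i \<in> {1..d} \<Longrightarrow> U i \<in> carrier_mat (n i) (r i)"
    and T: "\<And>j. j \<in> tuples {1..d} n \<Longrightarrow> T j = multilinear_mult d U G j"
  shows "tensor_unfolding enum d n I T
    = kronecker enum ({1..d} - I) U * tensor_unfolding enum d r I G * transpose_mat (kronecker enum I U)"
proof (rule eq_matI)
  let ?J = "{1..d} - I"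
  let ?nI = "\<Prod>j\<in>I. n j" and ?nJ = "\<Prod>j\<in>?J. n j" and ?rI = "\<Prod>j\<in>I. r j" and ?rJ = "\<Prod>j\<in>?J. r j"
  let ?A = "kronecker enum I U" and ?B = "kronecker enum ?J U" and ?G = "tensor_unfolding enum d r I G"
  have fin: "finite I" "finite ?J" using I finite_subset by auto
  have UI: "\<And>i. i \<in> I \<Longrightarrow> U i \<in> carrier_mat (n i) (r i)" using U I by blast
  have UJ: "\<And>i. i \<in> ?J \<Longrightarrow> U i \<in> carrier_mat (n i) (r i)" using U by blast
  have A: "?A \<in> carrier_mat ?nI ?rI" using kronecker_carrier[of I U n r, OF UI] .
  have B: "?B \<in> carrier_mat ?nJ ?rJ" using kronecker_carrier[of ?J U n r, OF UJ] .
  show "dim_row (tensor_unfolding enum d n I T) = dim_row (?B * ?G * transpose_mat ?A)"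
    "dim_col (tensor_unfolding enum d n I T) = dim_col (?B * ?G * transpose_mat ?A)"
    using A B by (auto simp: tensor_unfolding_def Let_def)
  fix a b assume "a < dim_row (?B * ?G * transpose_mat ?A)" "b < dim_col (?B * ?G * transpose_mat ?A)"
  then have a: "a < ?nJ" and b: "b < ?nI" using A B by auto
  note eI = tuple_ordering_bij[OF ord fin(1), of r] and eJ = tuple_ordering_bij[OF ord fin(2), of r]
  define k where "k = (\<lambda>j. if j \<in> I then enum (tuples I n) b j else enum (tuples ?J n) a j)"
  have k: "k \<in> tuples {1..d} n"
    unfolding k_def using bij_betwE[OF tuple_ordering_bij[OF ord fin(1), of n]] a b
      bij_betwE[OF tuple_ordering_bij[OF ord fin(2), of n]] by (intro merge_tuples[OF I]) auto
  define F where "F i = (\<Prod>t\<in>{1..d}. U t $$ (k t, i t)) * G i" for i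
  have dims: "tuples {1..d} (\<lambda>t. dim_col (U t)) = tuples {1..d} r"
    using U by (intro tuples_cong) auto
  have "tensor_unfolding enum d n I T $$ (a, b) = (\<Sum>i\<in>tuples {1..d} r. F i)"
    using T[OF k] unfolding unfolding_index[OF a b] k_def[symmetric]
    by (simp add: multilinear_mult_def F_def dims del: One_nat_def)
  also have "\<dots> = (\<Sum>x\<in>tuples ?J r. \<Sum>y\<in>tuples I r. F (\<lambda>j. if j \<in> I then y j else x j))"
    by (rule sum_tuples_split[OF I])
  also have "\<dots> = (\<Sum>x\<in>tuples ?J r. \<Sum>b'<?rI. F (\<lambda>j. if j \<in> I then enum (tuples I r) b' j else x j))"
    by (intro sum.cong refl sum.reindex_bij_betw[OF eI, symmetric])
  also have "\<dots> = (\<Sum>a'<?rJ. \<Sum>b'<?rI.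
      F (\<lambda>j. if j \<in> I then enum (tuples I r) b' j else enum (tuples ?J r) a' j))"
    by (rule sum.reindex_bij_betw[OF eJ, symmetric])
  also have "\<dots> = (\<Sum>a'<?rJ. \<Sum>b'<?rI. ?B $$ (a, a') * ?G $$ (a', b') * ?A $$ (b, b'))"
  proof (intro sum.cong refl)
    fix a' b' assume "a' \<in> {..<?rJ}" "b' \<in> {..<?rI}"
    then have a': "a' < ?rJ" and b': "b' < ?rI" by auto
    let ?i = "\<lambda>j. if j \<in> I then enum (tuples I r) b' j else enum (tuples ?J r) a' j"
    have "(\<Prod>t\<in>{1..d}. U t $$ (k t, ?i t))
        = (\<Prod>t\<in>?J. U t $$ (k t, ?i t)) * (\<Prod>t\<in>I. U t $$ (k t, ?i t))"
      by (rule prod.subset_diff[OF I]) simp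
    also have "(\<Prod>t\<in>?J. U t $$ (k t, ?i t)) = ?B $$ (a, a')"
      by (subst kronecker_index[of ?J U n r, OF UJ a a']) (auto simp: k_def intro!: prod.cong)
    also have "(\<Prod>t\<in>I. U t $$ (k t, ?i t)) = ?A $$ (b, b')"
      by (subst kronecker_index[of I U n r, OF UI b b']) (auto simp: k_def intro!: prod.cong)
    finally show "F ?i = ?B $$ (a, a') * ?G $$ (a', b') * ?A $$ (b, b')"
      by (simp add: F_def unfolding_index[OF a' b'])
  qed
  also have "\<dots> = (\<Sum>b'<?rI. (\<Sum>a'<?rJ. ?B $$ (a, a') * ?G $$ (a', b')) * ?A $$ (b, b'))"
    by (subst sum.swap) (simp add: sum_distrib_right)
  also have "\<dots> = (\<Sum>b'<?rI. (?B * ?G) $$ (a, b') * ?A $$ (b, b'))"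
    using a B carrier_matD[OF unfolding_carrier[of enum d r I G]]
    by (intro sum.cong) (auto simp: scalar_prod_def lessThan_atLeast0)
  also have "\<dots> = (?B * ?G * transpose_mat ?A) $$ (a, b)"
    using a b A B carrier_matD[OF unfolding_carrier[of enum d r I G]]
    by (simp add: scalar_prod_def lessThan_atLeast0 del: assoc_mult_mat)
  finally show "tensor_unfolding enum d n I T $$ (a, b) = (?B * ?G * transpose_mat ?A) $$ (a, b)" .
qed

text \<open>The coefficient product is the indicator of a single tuple, \<open>i0\<close>, so one
  summand survives.\<close>

lemma multilinear_mult_perm_mat:
  assumes p: "\<And>t. t \<in> {1..d} \<Longrightarrow> p t permutes {..<r t}" and j: "j \<in> tuples {1..d} r"
  shows "multilinear_mult d (\<lambda>t. transpose_mat (perm_mat (r t) (p t))) G j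
    = G (\<lambda>t\<in>{1..d}. p t (j t))"
proof -
  define i0 where "i0 = (\<lambda>t\<in>{1..d}. p t (j t))"
  have i0: "i0 \<in> tuples {1..d} r"
    using permutes_in_image[OF p] tuples_D[OF j] by (auto simp: i0_def tuples_def)
  have "multilinear_mult d (\<lambda>t. transpose_mat (perm_mat (r t) (p t))) G j
      = (\<Sum>i\<in>tuples {1..d} r. (\<Prod>t\<in>{1..d}. if i t = i0 t then 1 else 0) * G i)"
    unfolding multilinear_mult_def
    using tuples_D[OF j] tuples_D
    by (auto simp: perm_mat_def i0_def intro!: sum.cong prod.cong arg_cong2[of _ _ _ _ "(*)"])
  also have "\<dots> = (\<Sum>i\<in>tuples {1..d} r. if i = i0 then G i else 0)"
  proof (intro sum.cong refl)
    fix i assume i: "i \<in> tuples {1..d} r"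
    show "(\<Prod>t\<in>{1..d}. if i t = i0 t then 1 else 0) * G i = (if i = i0 then G i else 0)"
    proof (cases "i = i0")
      case False
      then obtain t where "t \<in> {1..d}" "i t \<noteq> i0 t"
        using i i0 unfolding tuples_def by (metis PiE_ext)
      then have "(\<Prod>t\<in>{1..d}. if i t = i0 t then 1 else (0::real)) = 0"
        by (intro prod_zero) auto
      then show ?thesis using False by simp
    qed simp
  qed
  also have "\<dots> = G i0" using i0 finite_tuples[of "{1..d}" r] by simp
  finally show ?thesis by (simp add: i0_def)
qed

section \<open>Uniqueness of the factors and of the core tensor\<close>

theorem theorem6p4:
  fixes d :: nat and n r :: "nat \<Rightarrow> nat" and I :: "nat set"
    and enum :: "tuple set \<Rightarrow> nat \<Rightarrow> tuple"
    and T Gsharp Gstar :: tensor and Usharp Ustar :: "nat \<Rightarrow> real mat"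
  assumes "tuple_ordering enum"
    and "\<And>i. i \<in> {1..d} \<Longrightarrow>
           Usharp i \<in> carrier_mat (n i) (r i) \<and> 0\<^sub>m (n i) (r i) \<le> Usharp i \<and>
           sum_to_one_columns (Usharp i)"
    and "\<And>j. j \<in> tuples {1..d} n \<Longrightarrow> T j = multilinear_mult d Usharp Gsharp j"
    and "I \<noteq> {}" and "I \<subset> {1..d}"
    and "satisfies_SSC (kronecker enum I Usharp)"
    and "satisfies_SSC (kronecker enum ({1..d} - I) Usharp)"
    and "vec_space.rank (\<Prod>j\<in>{1..d} - I. r j) (tensor_unfolding enum d r I Gsharp) = (\<Prod>i\<in>I. r i)"
    and "(\<Prod>i\<in>I. r i) = (\<Prod>j\<in>{1..d} - I. r j)"
    and "procedure_output enum d n r I T Ustar Gstar"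
  shows "\<exists>P. (\<forall>i\<in>{1..d}. permutation_matrix (r i) (P i) \<and> Ustar i = Usharp i * P i) \<and>
             (\<forall>j\<in>tuples {1..d} r.
                Gstar j = multilinear_mult d (\<lambda>i. transpose_mat (P i)) Gsharp j)"
proof -
  define J where "J = {1..d} - I"
  let ?nI = "\<Prod>j\<in>I. n j" and ?nJ = "\<Prod>j\<in>J. n j"
  define R where "R = (\<Prod>i\<in>I. r i)"
  have RJ: "(\<Prod>j\<in>J. r j) = R" using assms(9) by (simp add: R_def J_def)
  define A where "A = kronecker enum I Usharp"
  define B where "B = kronecker enum J Usharp"
  define G where "G = tensor_unfolding enum d r I Gsharp"
  note ord = assms(1)
  have I: "I \<subseteq> {1..d}" using assms(5) by blast
  have fin: "finite I" "finite J" using I finite_subset by (auto simp: J_def)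
  have U: "\<And>i. i \<in> {1..d} \<Longrightarrow> Usharp i \<in> carrier_mat (n i) (r i)" using assms(2) by blast
  have UI: "\<And>j. j \<in> I \<Longrightarrow> Usharp j \<in> carrier_mat (n j) (r j) \<and> sum_to_one_columns (Usharp j)"
    using assms(2) I by blast
  have UJ: "\<And>j. j \<in> J \<Longrightarrow> Usharp j \<in> carrier_mat (n j) (r j) \<and> sum_to_one_columns (Usharp j)"
    using assms(2) by (simp add: J_def)
  have A: "A \<in> carrier_mat ?nI R" "satisfies_SSC A" "sum_to_one_columns A"
    using kronecker_carrier[of I Usharp n r enum] UI assms(6)
      kronecker_sum_to_one_columns[of enum I Usharp n r, OF ord fin(1) UI] by (auto simp: A_def R_def)
  have B: "B \<in> carrier_mat ?nJ R" "satisfies_SSC B" "sum_to_one_columns B"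
    using kronecker_carrier[of J Usharp n r enum] UJ assms(7)[folded J_def]
      kronecker_sum_to_one_columns[of enum J Usharp n r, OF ord fin(2) UJ] by (auto simp: B_def RJ)
  have G: "G \<in> carrier_mat R R"
    using unfolding_carrier[of enum d r I Gsharp, folded J_def] by (simp add: G_def R_def[symmetric] RJ)
  \<comment> \<open>The unfolding is square by \<open>RJ\<close>, so the rank hypothesis means full
    rank.\<close>
  have det: "det G \<noteq> 0"
    using vec_space.det_rank_iff[OF G] assms(8)[folded J_def] by (simp add: G_def R_def[symmetric] RJ)
  have R0: "0 < R" using satisfies_SSC_D(1)[OF A(2,1)] by simp
  obtain UIs UJs K PI PJ where opt: "optimal_solution ?nI ?nJ R R (tensor_unfolding enum d n I T) UIs UJs K"
    and PI: "permutation_matrix R PI" and PJ: "permutation_matrix R PJ"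
    and V: "\<And>j. j \<in> {1..d} \<Longrightarrow> Ustar j \<in> carrier_mat (n j) (r j) \<and> sum_to_one_columns (Ustar j)"
    and kI: "UIs * PI = kronecker enum I Ustar" and kJ: "UJs * PJ = kronecker enum J Ustar"
    and Gs: "tensor_unfolding enum d r I Gstar = transpose_mat PJ * K * PI"
    using assms(10) unfolding procedure_output_def Let_def J_def[symmetric] R_def[symmetric] RJ by blast
  have "tensor_unfolding enum d n I T = B * G * transpose_mat A"
    unfolding A_def B_def G_def J_def by (rule unfolding_multilinear_mult[OF ord I U assms(3)])
  with opt obtain p q where p: "p permutes {..<R}" and q: "q permutes {..<R}"
    and UIs: "UIs = A * perm_mat R p" and UJs: "UJs = B * perm_mat R q"
    and K: "K = transpose_mat (perm_mat R q) * G * perm_mat R p"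
    using SSC_min_det_factorization_unique[OF A B G det] by metis
  obtain p' q' where p': "p' permutes {..<R}" "PI = perm_mat R p'" and q': "q' permutes {..<R}" "PJ = perm_mat R q'"
    using PI PJ by (auto simp: permutation_matrix_def perm_mat_def)
  \<comment> \<open>Column \<open>b\<close> after multiplying by both permutation matrices, that of
    the optimal solution and that of step 2, is column \<open>p (p' b)\<close>.\<close>
  define \<sigma> where "\<sigma> = p \<circ> p'"
  define \<tau> where "\<tau> = q \<circ> q'"
  have \<sigma>: "\<sigma> permutes {..<R}" unfolding \<sigma>_def by (rule permutes_compose[OF p'(1) p])
  have \<tau>: "\<tau> permutes {..<R}" unfolding \<tau>_def by (rule permutes_compose[OF q'(1) q])
  have lt: "p' b < R" "q' b < R" "\<sigma> b < R" "\<tau> b < R" if "b < R" for b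
    using that permutes_in_image[OF p'(1)] permutes_in_image[OF q'(1)] permutes_in_image[OF \<sigma>]
      permutes_in_image[OF \<tau>] by auto
  have colI: "kronecker enum I Ustar $$ (a, b) = A $$ (a, \<sigma> b)" if "a < ?nI" "b < R" for a b
    using that lt A(1) p p' unfolding kI[symmetric] UIs
    by (simp add: mult_perm_mat_index[of _ ?nI] \<sigma>_def del: assoc_mult_mat index_mult_mat(1))
  have colJ: "kronecker enum J Ustar $$ (a, b) = B $$ (a, \<tau> b)" if "a < ?nJ" "b < R" for a b
    using that lt B(1) q q' unfolding kJ[symmetric] UJs
    by (simp add: mult_perm_mat_index[of _ ?nJ] \<tau>_def del: assoc_mult_mat index_mult_mat(1))
  have G\<sigma>\<tau>: "tensor_unfolding enum d r I Gstar $$ (a, b) = G $$ (\<tau> a, \<sigma> b)" if "a < R" "b < R" for a b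
  proof -
    have Kc: "K \<in> carrier_mat R R" unfolding K using G by (intro mult_carrier_mat[of _ R R]) auto
    have "tensor_unfolding enum d r I Gstar $$ (a, b) = K $$ (q' a, p' b)"
      unfolding Gs p' q' by (rule perm_mat_mult_mult_index[OF Kc q'(1) p'(1) that])
    also have "\<dots> = G $$ (q (q' a), p (p' b))"
      unfolding K by (rule perm_mat_mult_mult_index[OF G q p lt(2,1)]) (use that in auto)
    finally show ?thesis by (simp add: \<sigma>_def \<tau>_def)
  qed
  have VI: "\<And>j. j \<in> I \<Longrightarrow> Ustar j \<in> carrier_mat (n j) (r j) \<and> sum_to_one_columns (Ustar j)"
    using V I by blast
  have VJ: "\<And>j. j \<in> J \<Longrightarrow> Ustar j \<in> carrier_mat (n j) (r j) \<and> sum_to_one_columns (Ustar j)"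
    using V by (simp add: J_def)
  have "\<exists>p. \<forall>t\<in>I. p t permutes {..<r t} \<and> Ustar t = Usharp t * perm_mat (r t) (p t) \<and>
      (\<forall>b<R. enum (tuples I r) (\<sigma> b) t = p t (enum (tuples I r) b t))"
    by (rule kronecker_column_permutation[of enum I Usharp n r Ustar \<sigma>, folded R_def A_def,
          OF ord fin(1) UI VI \<sigma> R0 colI SSC_col_inj[OF A(2,1)]])
  then obtain pI where pI: "\<forall>t\<in>I. pI t permutes {..<r t} \<and> Ustar t = Usharp t * perm_mat (r t) (pI t) \<and>
      (\<forall>b<R. enum (tuples I r) (\<sigma> b) t = pI t (enum (tuples I r) b t))" ..
  have "\<exists>p. \<forall>t\<in>J. p t permutes {..<r t} \<and> Ustar t = Usharp t * perm_mat (r t) (p t) \<and>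
      (\<forall>b<R. enum (tuples J r) (\<tau> b) t = p t (enum (tuples J r) b t))"
    by (rule kronecker_column_permutation[of enum J Usharp n r Ustar \<tau>, unfolded RJ, folded B_def,
          OF ord fin(2) UJ VJ \<tau> R0 colJ SSC_col_inj[OF B(2,1)]])
  then obtain pJ where pJ: "\<forall>t\<in>J. pJ t permutes {..<r t} \<and> Ustar t = Usharp t * perm_mat (r t) (pJ t) \<and>
      (\<forall>b<R. enum (tuples J r) (\<tau> b) t = pJ t (enum (tuples J r) b t))" ..
  define P where "P t = (if t \<in> I then pI t else pJ t)" for t
  have P: "P t permutes {..<r t}" if "t \<in> {1..d}" for t
    using that pI pJ by (simp add: P_def J_def)
  show ?thesis
  proof (intro exI[of _ "\<lambda>t. perm_mat (r t) (P t)"] conjI ballI)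
    fix t assume t: "t \<in> {1..d}"
    show "permutation_matrix (r t) (perm_mat (r t) (P t))"
      using P[OF t] by (auto simp: permutation_matrix_def perm_mat_def)
    show "Ustar t = Usharp t * perm_mat (r t) (P t)"
      using t pI pJ by (simp add: P_def J_def)
  next
    fix j assume j: "j \<in> tuples {1..d} r"
    \<comment> \<open>The two halves of \<open>j\<close> are encoded as a row number
      \<open>a\<close> and a column number \<open>b\<close> of the unfolded core.\<close>
    have "restrict j I \<in> tuples I r" "restrict j J \<in> tuples J r"
      using j I by (auto simp: tuples_def J_def)
    then obtain a b where a: "a < R" "enum (tuples J r) a = restrict j J"
      and b: "b < R" "enum (tuples I r) b = restrict j I"
      using bij_betw_imp_surj_on[OF tuple_ordering_bij[OF ord fin(1), of r]]
        bij_betw_imp_surj_on[OF tuple_ordering_bij[OF ord fin(2), of r]]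
      unfolding RJ R_def[symmetric] by (metis imageE lessThan_iff)
    have D: "t \<in> {1..d} \<longleftrightarrow> t \<in> I \<or> t \<in> J" for t
      using I by (auto simp: J_def)
    \<comment> \<open>The tuples must agree as functions, hence also at positions outside
      \<open>{1..d}\<close>, where extensionality supplies the value.\<close>
    have jout: "j t = undefined" if "t \<notin> I" "t \<notin> J" for t
      using j that D[of t] unfolding tuples_def PiE_def extensional_def by blast
    have ji: "(\<lambda>t. if t \<in> I then enum (tuples I r) b t else enum (tuples J r) a t) = j"
      by (rule ext) (simp add: a(2) b(2) jout)
    have "enum (tuples J r) (\<tau> a) \<in> tuples J r"
      using bij_betwE[OF tuple_ordering_bij[OF ord fin(2), of r]] lt(4)[OF a(1)] unfolding RJ by auto
    then have undef: "enum (tuples J r) (\<tau> a) t = undefined" if "t \<notin> J" for t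
      using that by (auto simp: tuples_def PiE_def extensional_def)
    have "Gstar j = tensor_unfolding enum d r I Gstar $$ (a, b)"
      using unfolding_index[of a r d I b enum Gstar, folded J_def] a b ji by (simp add: RJ R_def[symmetric])
    also have "\<dots> = G $$ (\<tau> a, \<sigma> b)" by (rule G\<sigma>\<tau>[OF a(1) b(1)])
    also have "\<dots> = Gsharp (\<lambda>t. if t \<in> I then enum (tuples I r) (\<sigma> b) t else enum (tuples J r) (\<tau> a) t)"
      using unfolding_index[of "\<tau> a" r d I "\<sigma> b" enum Gsharp, folded J_def] lt(4)[OF a(1)] lt(3)[OF b(1)]
      by (simp add: G_def RJ R_def[symmetric])
    \<comment> \<open>Here the last clauses of \<open>pI\<close> and \<open>pJ\<close> turn the row
      and column permutations into index permutations of the individual modes.\<close>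
    also have "(\<lambda>t. if t \<in> I then enum (tuples I r) (\<sigma> b) t else enum (tuples J r) (\<tau> a) t)
        = (\<lambda>t\<in>{1..d}. P t (j t))"
    proof (rule ext)
      fix t
      show "(if t \<in> I then enum (tuples I r) (\<sigma> b) t else enum (tuples J r) (\<tau> a) t)
          = (\<lambda>t\<in>{1..d}. P t (j t)) t"
        using pI pJ a b undef by (simp add: P_def D del: atLeastAtMost_iff One_nat_def)
    qed
    also have "Gsharp \<dots> = multilinear_mult d (\<lambda>t. transpose_mat (perm_mat (r t) (P t))) Gsharp j"
      by (rule multilinear_mult_perm_mat[OF P j, symmetric])
    finally show "Gstar j = multilinear_mult d (\<lambda>t. transpose_mat (perm_mat (r t) (P t))) Gsharp j" .
  qed
qed

end
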